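(* For all $n\ge1$, the map $\varphi$ satisfies $$\varphi(E^{\mathrm{B}}_{n\delta})=(-1)^n\,\frac{\{2n\}_q}{n}\,q^{-2n}(q+q^{-1})^{2n-1}\,xC^{s}_{n-1}y,$$ where $xC^{s}_{n-1}y$ is a concatenation (free) product.
   Context: Ground field $\mathbb{F}=\mathbb{Q}(q)$, $q$ an indeterminate; $\{n\}_q=\frac{q^{-n}-(-1)^nq^n}{q+q^{-1}}$. $U_q^{+}=U_q^{+}(C(2)^{(2)})$ is the unital associative $\mathbb{F}$-superalgebra with odd generators $A,B$ and relations $A^3B+\{3\}_qA^2BA-\{3\}_qABA^2-BA^3=0$, $B^3A+\{3\}_qB^2AB-\{3\}_qBAB^2-AB^3=0$. In it define (PBW generators of Damiani type) $E_{\alpha_0}=A$, $E_{\alpha_1}=B$, $E_\delta=q^{-2}BA+AB$, and for $n\ge1$ $$E_{n\delta+\alpha_0}=\frac{[E_{(n-1)\delta+\alpha_0},E_\delta]}{q-q^{-1}},\quad E_{n\delta+\alpha_1}=\frac{[E_\delta,E_{(n-1)\delta+\alpha_1}]}{q-q^{-1}},\quad E_{n\delta}=q^{-2}E_{(n-1)\delta+\alpha_1}A+AE_{(n-1)\delta+\alpha_1},$$ where $[a,b]=ab-(-1)^{|a||b|}ba$ is the super-commutator ($E_{n\delta}$ even, $E_{n\delta+\alpha_i}$ odd, so here $[a,b]=ab-ba$). The elements $E_{n\delta}$, $n\geq 1$, mutually commute. The elements $E^{\mathrm{B}}_{n\delta}$ ($n\ge1$) of Beck type in $U_q^+$ are defined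 by the identity of formal power series in $t$ $$\exp\Big(-(q+q^{-1})\sum_{k\ge1}E^{\mathrm{B}}_{k\delta}t^k\Big)=1-(q+q^{-1})\sum_{k\ge1}E_{k\delta}t^k .$$ $\mathbb{V}$ is the free associative unital $\mathbb{F}$-algebra on noncommuting $x,y$; words form a basis; the empty word is $1$; juxtaposition denotes concatenation. The $q$-shuffle superproduct $\star$ is the bilinear associative product on $\mathbb{V}$ with $1\star v=v\star1=v$ and, for nontrivial words $u=u_1\cdots u_r$, $v=v_1\cdots v_s$, recursively $$u\star v=u_1\big((u_2\cdots u_r)\star v\big)+(-1)^r v_1\big(u\star(v_2\cdots v_s)\big)q^{\langle u_1,v_1\rangle+\cdots+\langle u_r,v_1\rangle},$$ where $\langle x,x\rangle=\langle y,y\rangle=2$, $\langle x,y\rangle=\langle y,x\rangle=-2$. $\varphi:U_q^+\to(\mathbb{V},\star)$ is the (injective) superalgebra homomorphism with $A\mapsto x$, $B\mapsto y$. Catalan elements: put $\bar x=1$, $\bar y=-1$. A word $a_1\cdots a_m$ is Catalan if $\bar a_1+\cdots+\bar a_m=0$ and $\bar a_1+\cdots+\bar a_i\ge0$ for all $1\le i\le m$. $\mathrm{Cat}_n$ is the set of Catalan words of length $2n$. Define $C^s(1)=1$, and for $n\ge1$, $w\in\mathrm{Cat}_n$, $$C^{s}(w)=\sum_{v\in\mathrm{Cat}_{n-1}}C^{s}(v)\sum_i(-1)^i\{2+2\bar a_1+\cdots+2\bar a_i\}_q,$$ where, for $v=a_1\cdots a_m$ ($m=2n-2$), the inner sum is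 over the $i$, $0\le i\le m$, such that $w=a_1\cdots a_i\,x\,a_{i+1}\cdots a_m\,y$. Set $C^{s}_n=\sum_{w\in\mathrm{Cat}_n}C^s(w)\,w\in\mathbb{V}$ (so $C^s_0=1$, $C^s_1=\{2\}_qxy$). *)

theory Defs
  imports
    "HOL-Library.Poly_Mapping"
    "HOL-Computational_Algebra.Fraction_Field"
    "HOL-Computational_Algebra.Polynomial"
    "HOL-Computational_Algebra.Formal_Power_Series"
begin

type_synonym ratfun = "rat poly fract"

definition qvar :: ratfun
  where "qvar = Fraction_Field.Fract [:0, 1:] 1"

definition qint :: "int \<Rightarrow> ratfun"
  where "qint n = (qvar powi (- n) - (-1) powi n * qvar powi n) / (qvar + inverse qvar)"

text \<open>Lists form a monoid under concatenation. The convolution product of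
  \<^typ>\<open>'a \<Rightarrow>\<^sub>0 'b\<close> then makes \<open>'l list \<Rightarrow>\<^sub>0 ratfun\<close> the free associative unital algebra on
  the letters \<open>'l\<close>: its basis consists of the words, its product is concatenation, and its
  unit is the empty word.\<close>

instantiation list :: (type) monoid_add
begin

definition zero_list :: "'a list" where "zero_list = []"

definition plus_list :: "'a list \<Rightarrow> 'a list \<Rightarrow> 'a list" where "plus_list = append"

instance
  by standard (simp_all add: zero_list_def plus_list_def)

end

type_synonym 'l free_alg = "'l list \<Rightarrow>\<^sub>0 ratfun"

definition word :: "'l list \<Rightarrow> 'l free_alg"
  where "word w = Poly_Mapping.single w 1"

definition scale :: "ratfun \<Rightarrow> 'l free_alg \<Rightarrow> 'l free_alg"  (infixr \<open>*\<^sub>f\<close> 75)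
  where "scale c p = Poly_Mapping.map ((*) c) p"

definition lin_ext :: "('k list \<Rightarrow> 'l free_alg) \<Rightarrow> 'k free_alg \<Rightarrow> 'l free_alg"
  where "lin_ext f p = (\<Sum>w\<in>Poly_Mapping.keys p. Poly_Mapping.lookup p w *\<^sub>f f w)"

lemma word_Nil: "word [] = 1"
  by (simp add: word_def flip: zero_list_def)

lemma word_mult: "word u * word v = word (u @ v)"
  by (simp add: word_def mult_single plus_list_def)

lemma lookup_scale [simp]: "Poly_Mapping.lookup (c *\<^sub>f p) w = c * Poly_Mapping.lookup p w"
  by (simp add: scale_def map.rep_eq when_def)

lemma scale_conv: "c *\<^sub>f p = Poly_Mapping.single [] c * p"
  unfolding scale_def mult_map_scale_conv_mult by (simp add: zero_list_def)

lemma scale_one [simp]: "1 *\<^sub>f p = p"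
  and scale_zero [simp]: "0 *\<^sub>f p = 0"
  and scale_zero_right [simp]: "c *\<^sub>f 0 = (0 :: 'l free_alg)"
  and scale_add_right: "c *\<^sub>f (p + r) = c *\<^sub>f p + c *\<^sub>f (r :: 'l free_alg)"
  and scale_diff_right: "c *\<^sub>f (p - r) = c *\<^sub>f p - c *\<^sub>f (r :: 'l free_alg)"
  and scale_add_left: "(c + d) *\<^sub>f p = c *\<^sub>f p + d *\<^sub>f p"
  and scale_scale: "c *\<^sub>f (d *\<^sub>f p) = (c * d) *\<^sub>f p"
  and scale_minus_one: "(- 1) *\<^sub>f p = - p"
  by (rule poly_mapping_eqI; simp add: lookup_add lookup_minus algebra_simps)+

lemma scale_mult_left: "(c *\<^sub>f p) * r = c *\<^sub>f (p * r)"
  by (simp add: scale_conv mult.assoc)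

lemma single_eq_scale: "Poly_Mapping.single w c = c *\<^sub>f word w"
  by (rule poly_mapping_eqI) (simp add: word_def lookup_single when_def)

lemma free_alg_induct [case_names word add scale]:
  assumes "\<And>w. P (word w)" "\<And>p r. P p \<Longrightarrow> P r \<Longrightarrow> P (p + r)" "\<And>c p. P p \<Longrightarrow> P (c *\<^sub>f p)"
  shows "P p"
proof (induction p rule: update_induct)
  case const
  show ?case using assms(3)[OF assms(1), of 0] by simp
next
  case (update f a b)
  have "Poly_Mapping.update a b f = f + b *\<^sub>f word a"
    using update.hyps
    by (intro poly_mapping_eqI)
      (auto simp: lookup_update lookup_add word_def lookup_single when_def in_keys_iff)
  then show ?case using assms update.IH by metis
qed

lemma single_Nil_commute: "Poly_Mapping.single [] c * p = p * Poly_Mapping.single [] (c::ratfun)"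
proof (induction p rule: free_alg_induct)
  case (word w)
  then show ?case by (simp add: word_def mult_single plus_list_def)
next
  case (add p r)
  then show ?case by (simp add: distrib_left distrib_right)
next
  case (scale d p)
  have "Poly_Mapping.single [] c * (d *\<^sub>f p) = Poly_Mapping.single [] (c * d) * p"
    by (simp add: scale_conv mult_single plus_list_def flip: mult.assoc)
  also have "\<dots> = Poly_Mapping.single [] d * (Poly_Mapping.single [] c * p)"
    by (simp add: mult_single plus_list_def mult.commute flip: mult.assoc)
  also have "\<dots> = (d *\<^sub>f p) * Poly_Mapping.single [] c"
    by (simp add: scale.IH scale_conv mult.assoc)
  finally show ?case .
qed

lemma scale_mult_right: "p * (c *\<^sub>f r) = c *\<^sub>f (p * r)"
  by (metis scale_conv single_Nil_commute mult.assoc)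

lemma scale_sum: "c *\<^sub>f (\<Sum>i\<in>I. f i) = (\<Sum>i\<in>I. c *\<^sub>f (f i :: 'l free_alg))"
  by (induction I rule: infinite_finite_induct) (simp_all add: scale_add_right)

lemma lin_ext_superset:
  assumes "finite S" "Poly_Mapping.keys p \<subseteq> S"
  shows "lin_ext f p = (\<Sum>w\<in>S. Poly_Mapping.lookup p w *\<^sub>f f w)"
  unfolding lin_ext_def using assms
  by (intro sum.mono_neutral_left) (auto simp: in_keys_iff)

lemma lin_ext_add: "lin_ext f (p + r) = lin_ext f p + lin_ext f r"
proof -
  let ?S = "Poly_Mapping.keys p \<union> Poly_Mapping.keys r"
  have "lin_ext f (p + r) = (\<Sum>w\<in>?S. Poly_Mapping.lookup (p + r) w *\<^sub>f f w)"
    by (rule lin_ext_superset) (use Poly_Mapping.keys_add[of p r] in auto)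
  moreover have "lin_ext f p = (\<Sum>w\<in>?S. Poly_Mapping.lookup p w *\<^sub>f f w)"
    by (rule lin_ext_superset) auto
  moreover have "lin_ext f r = (\<Sum>w\<in>?S. Poly_Mapping.lookup r w *\<^sub>f f w)"
    by (rule lin_ext_superset) auto
  ultimately show ?thesis by (simp add: lookup_add scale_add_left sum.distrib)
qed

lemma lin_ext_scale: "lin_ext f (c *\<^sub>f p) = c *\<^sub>f lin_ext f p"
proof -
  have "lin_ext f (c *\<^sub>f p) = (\<Sum>w\<in>Poly_Mapping.keys p. Poly_Mapping.lookup (c *\<^sub>f p) w *\<^sub>f f w)"
    by (rule lin_ext_superset) (auto simp: in_keys_iff)
  then show ?thesis by (simp add: lin_ext_def scale_sum scale_scale)
qed

lemma lin_ext_word [simp]: "lin_ext f (word w) = f w"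
  by (simp add: lin_ext_def word_def)

lemma lin_ext_zero [simp]: "lin_ext f 0 = 0"
  by (simp add: lin_ext_def)

lemma lin_ext_cong:
  assumes "\<And>w. w \<in> Poly_Mapping.keys p \<Longrightarrow> f w = g w"
  shows "lin_ext f p = lin_ext g p"
  by (simp add: lin_ext_def assms)

lemma lin_ext_comp:
  assumes "\<And>p r. F (p + r) = F p + F r" "\<And>c p. F (c *\<^sub>f p) = c *\<^sub>f F p"
  shows "F (lin_ext f p) = lin_ext (\<lambda>w. F (f w)) p"
  by (induction p rule: free_alg_induct) (simp_all add: lin_ext_add lin_ext_scale assms)

lemma lin_ext_fun_add: "lin_ext (\<lambda>w. f w + g w) p = lin_ext f p + lin_ext g p"
  by (simp add: lin_ext_def scale_add_right sum.distrib)

lemma lin_ext_fun_scale: "lin_ext (\<lambda>w. c *\<^sub>f f w) p = c *\<^sub>f lin_ext f p"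
  by (simp add: lin_ext_def scale_scale scale_sum mult.commute)

datatype gen = GA | GB

definition fA :: "gen free_alg" where "fA = word [GA]"
definition fB :: "gen free_alg" where "fB = word [GB]"

definition serre_relators :: "gen free_alg set"
  where "serre_relators =
    {fA ^ 3 * fB + qint 3 *\<^sub>f (fA ^ 2 * fB * fA) - qint 3 *\<^sub>f (fA * fB * fA ^ 2) - fB * fA ^ 3,
     fB ^ 3 * fA + qint 3 *\<^sub>f (fB ^ 2 * fA * fB) - qint 3 *\<^sub>f (fB * fA * fB ^ 2) - fA * fB ^ 3}"

inductive_set serre_ideal :: "gen free_alg set"
  where
    zero: "0 \<in> serre_ideal"
  | gen: "r \<in> serre_relators \<Longrightarrow> a * r * b \<in> serre_ideal"
  | add: "p \<in> serre_ideal \<Longrightarrow> p' \<in> serre_ideal \<Longrightarrow> p + p' \<in> serre_ideal"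

lemma serre_ideal_mult_left: "p \<in> serre_ideal \<Longrightarrow> a * p \<in> serre_ideal"
  by (induction rule: serre_ideal.induct)
    (auto simp: distrib_left intro: serre_ideal.intros,
     metis mult.assoc serre_ideal.gen)

lemma serre_ideal_mult_right: "p \<in> serre_ideal \<Longrightarrow> p * b \<in> serre_ideal"
  by (induction rule: serre_ideal.induct)
    (auto simp: distrib_right intro: serre_ideal.intros,
     metis mult.assoc serre_ideal.gen)

lemma serre_ideal_scale: "p \<in> serre_ideal \<Longrightarrow> c *\<^sub>f p \<in> serre_ideal"
  by (simp add: scale_conv serre_ideal_mult_left)

lemma serre_ideal_uminus: "p \<in> serre_ideal \<Longrightarrow> - p \<in> serre_ideal"
  using serre_ideal_mult_left[of p "- 1"] by simp

definition serre_eq :: "gen free_alg \<Rightarrow> gen free_alg \<Rightarrow> bool"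
  where "serre_eq p r \<longleftrightarrow> p - r \<in> serre_ideal"

lemma equivp_serre_eq: "equivp serre_eq"
proof (rule equivpI)
  show "reflp serre_eq" by (simp add: reflp_def serre_eq_def serre_ideal.zero)
  show "symp serre_eq"
    unfolding symp_def serre_eq_def using serre_ideal_uminus by fastforce
  show "transp serre_eq"
  proof (rule transpI)
    fix p r t :: "gen free_alg"
    assume "serre_eq p r" "serre_eq r t"
    then have "(p - r) + (r - t) \<in> serre_ideal"
      unfolding serre_eq_def by (rule serre_ideal.add)
    then show "serre_eq p t" by (simp add: serre_eq_def)
  qed
qed

quotient_type uq = "gen free_alg" / serre_eq
  by (rule equivp_serre_eq)

lemma serre_eq_refl: "serre_eq p p"
  by (simp add: serre_eq_def serre_ideal.zero)

lemma lookup_mult_Nil: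
  "Poly_Mapping.lookup (p * r) [] = Poly_Mapping.lookup p [] * Poly_Mapping.lookup (r :: 'l free_alg) []"
proof (induction p rule: free_alg_induct)
  case (word u)
  show ?case
    by (induction r rule: free_alg_induct)
      (auto simp: word_mult scale_mult_right distrib_left lookup_add,
       auto simp: word_def lookup_single when_def)
qed (simp_all add: scale_mult_left distrib_right lookup_add)

lemma serre_ideal_lookup_Nil: "p \<in> serre_ideal \<Longrightarrow> Poly_Mapping.lookup p [] = 0"
proof (induction rule: serre_ideal.induct)
  case (gen r a b)
  have "Poly_Mapping.lookup fA [] = 0" "Poly_Mapping.lookup fB [] = 0"
    by (simp_all add: fA_def fB_def word_def lookup_single)
  then have "Poly_Mapping.lookup r [] = 0"
    using gen
    by (auto simp: serre_relators_def lookup_add lookup_minus lookup_mult_Nil)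
  then show ?case by (simp add: lookup_mult_Nil)
qed (simp_all add: lookup_add)

lift_definition scale_uq :: "ratfun \<Rightarrow> uq \<Rightarrow> uq"  (infixr \<open>*\<^sub>u\<close> 75) is scale
  unfolding serre_eq_def by (metis scale_diff_right serre_ideal_scale)

instantiation uq :: ring_1
begin

lift_definition zero_uq :: uq is 0 .
lift_definition one_uq :: uq is 1 .

lift_definition plus_uq :: "uq \<Rightarrow> uq \<Rightarrow> uq" is "(+)"
  unfolding serre_eq_def by (metis add_diff_add serre_ideal.add)

lift_definition uminus_uq :: "uq \<Rightarrow> uq" is uminus
  unfolding serre_eq_def by (metis minus_diff_minus serre_ideal_uminus)

lift_definition minus_uq :: "uq \<Rightarrow> uq \<Rightarrow> uq" is "(-)"
proof -
  fix a a' b b' :: "gen free_alg"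
  assume "serre_eq a a'" "serre_eq b b'"
  then have "(a - a') + - (b - b') \<in> serre_ideal"
    unfolding serre_eq_def by (intro serre_ideal.add serre_ideal_uminus)
  then show "serre_eq (a - b) (a' - b')"
    unfolding serre_eq_def by (simp add: algebra_simps)
qed

lift_definition times_uq :: "uq \<Rightarrow> uq \<Rightarrow> uq" is "(*)"
proof -
  fix a a' b b' :: "gen free_alg"
  assume "serre_eq a a'" "serre_eq b b'"
  then have "(a - a') * b + a' * (b - b') \<in> serre_ideal"
    unfolding serre_eq_def
    by (intro serre_ideal.add serre_ideal_mult_left serre_ideal_mult_right)
  then show "serre_eq (a * b) (a' * b')"
    unfolding serre_eq_def by (simp add: algebra_simps)
qed

instance
proof
  show "(0::uq) \<noteq> 1"
    by transfer
      (auto simp: serre_eq_def lookup_minus lookup_one zero_list_def dest!: serre_ideal_lookup_Nil)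
qed (transfer, simp add: algebra_simps serre_eq_refl)+

end

lemma scale_uq_add_left: "(c + d) *\<^sub>u a = c *\<^sub>u a + d *\<^sub>u a"
  and scale_uq_add_right: "c *\<^sub>u (a + b) = c *\<^sub>u a + c *\<^sub>u b"
  and scale_uq_scale: "c *\<^sub>u (d *\<^sub>u a) = (c * d) *\<^sub>u a"
  and scale_uq_one: "1 *\<^sub>u a = a"
  and scale_uq_zero_left: "0 *\<^sub>u a = 0"
  and scale_uq_zero: "c *\<^sub>u 0 = 0"
  and scale_uq_mult_left: "(c *\<^sub>u a) * b = c *\<^sub>u (a * b)"
  and scale_uq_mult_right: "a * (c *\<^sub>u b) = c *\<^sub>u (a * b)"
  by (transfer; simp add: serre_eq_refl scale_add_left scale_add_right scale_scale
      scale_mult_left scale_mult_right)+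

lift_definition uA :: uq is fA .
lift_definition uB :: uq is fB .

text \<open>All commutators here are super-commutators with one even entry \<open>E\<^sub>\<delta>\<close>, hence ordinary
  commutators.\<close>

definition E_delta :: uq
  where "E_delta = (qvar powi (-2)) *\<^sub>u (uB * uA) + uA * uB"

fun E_alpha0 :: "nat \<Rightarrow> uq"
  where
    "E_alpha0 0 = uA"
  | "E_alpha0 (Suc n) =
      inverse (qvar - inverse qvar) *\<^sub>u (E_alpha0 n * E_delta - E_delta * E_alpha0 n)"

fun E_alpha1 :: "nat \<Rightarrow> uq"
  where
    "E_alpha1 0 = uB"
  | "E_alpha1 (Suc n) =
      inverse (qvar - inverse qvar) *\<^sub>u (E_delta * E_alpha1 n - E_alpha1 n * E_delta)"

text \<open>Only the values for \<open>n \<ge> 1\<close> are meaningful.\<close>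

definition E_ndelta :: "nat \<Rightarrow> uq"
  where "E_ndelta n = (qvar powi (-2)) *\<^sub>u (E_alpha1 (n - 1) * uA) + uA * E_alpha1 (n - 1)"

lemma E_ndelta_1: "E_ndelta 1 = E_delta"
  by (simp add: E_ndelta_def E_delta_def)

text \<open>The exponential \<open>\<Sum>\<^sub>m F\<^sup>m / m!\<close> of a power series \<open>F\<close> with constant term \<open>0\<close>; the powers
  with \<open>m > n\<close> do not contribute to the coefficient of \<open>t\<^sup>n\<close>.\<close>

definition exp_series :: "uq fps \<Rightarrow> uq fps"
  where "exp_series F = Abs_fps (\<lambda>n. \<Sum>m\<le>n. inverse (fact m) *\<^sub>u fps_nth (F ^ m) n)"

definition gen_series :: "(nat \<Rightarrow> uq) \<Rightarrow> uq fps"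
  where "gen_series e = Abs_fps (\<lambda>k. if k = 0 then 0 else e k)"

definition scale_series :: "ratfun \<Rightarrow> uq fps \<Rightarrow> uq fps"
  where "scale_series c F = Abs_fps (\<lambda>k. c *\<^sub>u fps_nth F k)"

definition beck_identity :: "(nat \<Rightarrow> uq) \<Rightarrow> bool"
  where "beck_identity e \<longleftrightarrow>
    exp_series (scale_series (- (qvar + inverse qvar)) (gen_series e))
      = 1 - scale_series (qvar + inverse qvar) (gen_series E_ndelta)"

text \<open>The identity determines \<open>e k\<close> for \<open>k \<ge> 1\<close> uniquely (see \<open>beck_identity_unique\<close> below); the
  irrelevant value at \<open>0\<close> is fixed to be \<open>0\<close>.\<close>

definition E_Beck :: "nat \<Rightarrow> uq"
  where "E_Beck = (THE e. e 0 = 0 \<and> beck_identity e)"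

lemma fps_power_nth_cong:
  fixes F G :: "uq fps"
  assumes "fps_nth F 0 = 0" "fps_nth G 0 = 0"
    and "\<And>k. k < n \<Longrightarrow> fps_nth F k = fps_nth G k"
    and "m \<ge> 2" "l \<le> n"
  shows "fps_nth (F ^ m) l = fps_nth (G ^ m) l"
proof -
  have base: "fps_nth (F ^ m) l = fps_nth (G ^ m) l" if "l < n" for m l
    using that
  proof (induction m arbitrary: l)
    case (Suc m)
    then show ?case by (auto simp: fps_mult_nth assms(3) intro!: sum.cong)
  qed simp
  obtain j where j: "m = Suc (Suc j)"
    using assms(4) by (metis add_2_eq_Suc le_Suc_ex)
  show ?thesis
  proof (cases "l < n")
    case False
    with assms(5) have l: "l = n" by simp
    have zero: "fps_nth (H ^ Suc j) 0 = 0" if "fps_nth H 0 = 0" for H :: "uq fps"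
      using that by simp
    have "fps_nth (F * F ^ Suc j) n = fps_nth (G * G ^ Suc j) n"
      unfolding fps_mult_nth
    proof (rule sum.cong)
      fix i assume "i \<in> {0..n}"
      then consider "i = 0" | "i = n" | "i < n" "n - i < n" by fastforce
      then show "fps_nth F i * fps_nth (F ^ Suc j) (n - i) = fps_nth G i * fps_nth (G ^ Suc j) (n - i)"
      proof cases
        case 1
        then show ?thesis by (simp add: assms(1,2))
      next
        case 2
        then show ?thesis by (simp only: diff_self_eq_0 zero[OF assms(1)] zero[OF assms(2)]) simp
      next
        case 3
        then show ?thesis by (simp only: assms(3) base)
      qed
    qed simp
    then show ?thesis by (simp add: j l)
  qed (rule base)
qed

lemma exp_series_nth:
  assumes "n \<ge> 1"
  shows "fps_nth (exp_series F) n
    = fps_nth F n + (\<Sum>m=2..n. inverse (fact m) *\<^sub>u fps_nth (F ^ m) n)"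
proof -
  have *: "{..n} = insert 0 (insert 1 {2..n})" using assms by auto
  show ?thesis using assms by (simp add: exp_series_def * scale_uq_one scale_uq_zero)
qed

lemma exp_series_nth_0: "fps_nth (exp_series F) 0 = 1"
  by (simp add: exp_series_def scale_uq_one)

lemma qvar_sum_nonzero: "qvar + inverse qvar \<noteq> 0"
  and qvar_nonzero: "qvar \<noteq> 0"
proof -
  show nz: "qvar \<noteq> 0" by (simp add: qvar_def Zero_fract_def eq_fract)
  have "qvar * qvar + 1 \<noteq> 0"
    by (simp add: qvar_def Zero_fract_def One_fract_def eq_fract one_pCons)
  moreover have "qvar * (qvar + inverse qvar) = qvar * qvar + 1"
    using nz by (simp add: distrib_left)
  ultimately show "qvar + inverse qvar \<noteq> 0" by fastforce
qed

lemma beck_identity_ex1: "\<exists>!e. e 0 = 0 \<and> beck_identity e"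
proof -
  define c where "c = - (qvar + inverse qvar)"
  have c: "c \<noteq> 0" using qvar_sum_nonzero by (simp only: c_def neg_equal_0_iff_equal not_False_eq_True)
  define S where "S e = scale_series c (gen_series e)" for e
  define T where "T e n = (\<Sum>m=2..n. inverse (fact m) *\<^sub>u fps_nth (S e ^ m) n)" for e n
  have S_nth: "fps_nth (S e) n = (if n = 0 then 0 else c *\<^sub>u e n)" for e n
    by (simp add: S_def scale_series_def gen_series_def scale_uq_zero)
  have T_cong: "T e n = T e' n" if "\<And>k. k < n \<Longrightarrow> e k = e' k" for e e' n
    unfolding T_def
    by (intro sum.cong refl arg_cong[where f = "scale_uq _"] fps_power_nth_cong[where n = n])
      (auto simp: S_nth that)
  have cneg: "- (d *\<^sub>u a) = (- d) *\<^sub>u a" for d a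
    using scale_uq_add_left[of d "- d" a] by (simp add: scale_uq_zero_left minus_unique)
  have exp_S: "fps_nth (exp_series (S e)) n = c *\<^sub>u e n + T e n" if "n \<ge> 1" for e n
    using that by (simp add: exp_series_nth S_nth T_def)
  have eqv: "beck_identity e \<longleftrightarrow> (\<forall>n\<ge>1. c *\<^sub>u e n + T e n = c *\<^sub>u E_ndelta n)" for e
  proof -
    have "beck_identity e \<longleftrightarrow>
      (\<forall>n. fps_nth (exp_series (S e)) n = (if n = 0 then 1 else c *\<^sub>u E_ndelta n))"
      unfolding beck_identity_def fps_eq_iff S_def c_def
      by (intro all_cong1) (auto simp: scale_series_def gen_series_def scale_uq_zero cneg)
    also have "\<dots> \<longleftrightarrow> (\<forall>n\<ge>1. c *\<^sub>u e n + T e n = c *\<^sub>u E_ndelta n)"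
      using exp_S exp_series_nth_0 by (metis not_one_le_zero less_one linorder_not_less)
    finally show ?thesis .
  qed
  have solve: "c *\<^sub>u a + b = c *\<^sub>u d \<longleftrightarrow> a = d - inverse c *\<^sub>u b" for a b d
  proof
    assume "c *\<^sub>u a + b = c *\<^sub>u d"
    then have "inverse c *\<^sub>u (c *\<^sub>u a + b) = inverse c *\<^sub>u (c *\<^sub>u d)" by simp
    then show "a = d - inverse c *\<^sub>u b"
      using c by (simp add: scale_uq_add_right scale_uq_scale scale_uq_one eq_diff_eq)
  next
    assume "a = d - inverse c *\<^sub>u b"
    then have "a + inverse c *\<^sub>u b = d" by simp
    then have "c *\<^sub>u (a + inverse c *\<^sub>u b) = c *\<^sub>u d" by simp
    then show "c *\<^sub>u a + b = c *\<^sub>u d"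
      using c by (simp add: scale_uq_add_right scale_uq_scale scale_uq_one)
  qed
  define R where "R e n = (if n = 0 then 0 else E_ndelta n - inverse c *\<^sub>u T e n)" for e n
  have R: "e 0 = 0 \<and> beck_identity e \<longleftrightarrow> (\<forall>n. e n = R e n)" for e
    unfolding eqv solve R_def by (auto simp: Suc_le_eq)
  have R_cong: "R e n = R e' n" if "\<And>k. k < n \<Longrightarrow> e k = e' k" for e e' n
    unfolding R_def using T_cong[OF that] by simp
  define e0 where "e0 = wfrec less_than R"
  have "adm_wf less_than R"
    unfolding adm_wf_def by (intro allI impI R_cong) simp
  then have "e0 n = R e0 n" for n
    unfolding e0_def by (rule wfrec_fixpoint[OF wf_less_than, THEN fun_cong])
  then have "e0 0 = 0 \<and> beck_identity e0" using R[of e0] by simp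
  moreover have "e = e'" if "e 0 = 0 \<and> beck_identity e" "e' 0 = 0 \<and> beck_identity e'" for e e'
  proof
    fix n
    show "e n = e' n"
    proof (induction n rule: less_induct)
      case (less n)
      have "e n = R e n" "e' n = R e' n" using that R[of e] R[of e'] by simp_all
      moreover have "R e n = R e' n" by (rule R_cong) (rule less)
      ultimately show ?case by simp
    qed
  qed
  ultimately show ?thesis by blast
qed

lemma beck_identity_E_Beck: "beck_identity E_Beck"
  unfolding E_Beck_def using theI'[OF beck_identity_ex1] by blast

lemma beck_identity_unique:
  assumes "beck_identity e" "k \<ge> 1"
  shows "e k = E_Beck k"
proof -
  have "gen_series (e(0 := 0)) = gen_series e"
    by (auto simp: gen_series_def fps_eq_iff)
  then have "beck_identity (e(0 := 0))"
    using assms(1) by (simp add: beck_identity_def)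
  then have "E_Beck = e(0 := 0)"
    unfolding E_Beck_def by (intro the1_equality[OF beck_identity_ex1]) simp
  then have "E_Beck k = (e(0 := 0)) k" by simp
  then show ?thesis using assms(2) by simp
qed

datatype letter = X | Y

fun pairing :: "letter \<Rightarrow> letter \<Rightarrow> int"
  where
    "pairing X X = 2"
  | "pairing Y Y = 2"
  | "pairing X Y = -2"
  | "pairing Y X = -2"

type_synonym shuffle_alg = "letter free_alg"

fun shuffle_word :: "letter list \<Rightarrow> letter list \<Rightarrow> shuffle_alg"
  where
    "shuffle_word [] v = word v"
  | "shuffle_word u [] = word u"
  | "shuffle_word (a # u) (b # v) =
      word [a] * shuffle_word u (b # v)
      + ((-1) ^ length (a # u) * qvar powi (\<Sum>c\<leftarrow>a # u. pairing c b))
          *\<^sub>f (word [b] * shuffle_word (a # u) v)"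

definition shuffle :: "shuffle_alg \<Rightarrow> shuffle_alg \<Rightarrow> shuffle_alg"  (infixl \<open>\<star>\<close> 70)
  where "p \<star> r = lin_ext (\<lambda>u. lin_ext (\<lambda>v. shuffle_word u v) r) p"

lemma shuffle_add_left: "(p + p') \<star> r = p \<star> r + p' \<star> r"
  and shuffle_scale_left: "(c *\<^sub>f p) \<star> r = c *\<^sub>f (p \<star> r)"
  by (simp_all add: shuffle_def lin_ext_add lin_ext_scale)

lemma shuffle_add_right: "p \<star> (r + r') = p \<star> r + p \<star> r'"
  and shuffle_scale_right: "p \<star> (c *\<^sub>f r) = c *\<^sub>f (p \<star> r)"
  by (simp_all add: shuffle_def lin_ext_add lin_ext_scale lin_ext_fun_add lin_ext_fun_scale)

lemma shuffle_word_word [simp]: "word u \<star> word v = shuffle_word u v"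
  by (simp add: shuffle_def)

lemma shuffle_word_Nil_right [simp]: "shuffle_word u [] = word u"
  by (cases u) simp_all

lemma shuffle_one_left [simp]: "1 \<star> p = p"
  by (induction p rule: free_alg_induct)
    (simp_all add: shuffle_add_right shuffle_scale_right flip: word_Nil)

lemma shuffle_one_right [simp]: "p \<star> 1 = p"
  by (induction p rule: free_alg_induct)
    (simp_all add: shuffle_add_left shuffle_scale_left flip: word_Nil)

text \<open>The scalar produced by moving the letter \<open>b\<close> to the left past the word \<open>u\<close>.\<close>

definition braid :: "letter list \<Rightarrow> letter \<Rightarrow> ratfun"
  where "braid u b = (-1) ^ length u * qvar powi (\<Sum>c\<leftarrow>u. pairing c b)"

lemma braid_Nil [simp]: "braid [] b = 1"
  by (simp add: braid_def)

lemma braid_append: "braid (u @ v) b = braid u b * braid v b"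
  by (simp add: braid_def power_add power_int_add qvar_nonzero)

lemma braid_Cons: "braid (a # u) b = braid [a] b * braid u b"
  using braid_append[of "[a]" u b] by (simp only: append_Cons append_Nil)

lemma shuffle_word_Cons:
  "shuffle_word (a # u) (b # v) = word [a] * shuffle_word u (b # v)
    + braid (a # u) b *\<^sub>f (word [b] * shuffle_word (a # u) v)"
  unfolding braid_def by (rule shuffle_word.simps(3))

lemmas [simp del] = shuffle_word.simps(3)

definition homog :: "(letter \<Rightarrow> ratfun) \<Rightarrow> shuffle_alg \<Rightarrow> bool"
  where "homog K p \<longleftrightarrow> (\<forall>w\<in>Poly_Mapping.keys p. \<forall>b. braid w b = K b)"

lemma homog_add: "homog K p \<Longrightarrow> homog K r \<Longrightarrow> homog K (p + r)"
  unfolding homog_def using Poly_Mapping.keys_add[of p r] by blast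

lemma homog_scale: "homog K p \<Longrightarrow> homog K (c *\<^sub>f p)"
  unfolding homog_def by (auto simp: in_keys_iff)

lemma homog_word: "homog K (word w) \<longleftrightarrow> (\<forall>b. braid w b = K b)"
  by (simp add: homog_def word_def)

lemma keys_Cons: "Poly_Mapping.keys (word [a] * p) \<subseteq> (#) a ` Poly_Mapping.keys p"
proof
  fix w assume "w \<in> Poly_Mapping.keys (word [a] * p)"
  then have "w \<in> {u + v | u v. u \<in> Poly_Mapping.keys (word [a]) \<and> v \<in> Poly_Mapping.keys p}"
    using keys_mult by blast
  moreover have "Poly_Mapping.keys (word [a]) = {[a]}"
    by (simp add: word_def)
  ultimately show "w \<in> (#) a ` Poly_Mapping.keys p"
    by (auto simp: plus_list_def)
qed

lemma homog_Cons:
  assumes "homog K p" "\<And>b. K' b = braid [a] b * K b"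
  shows "homog K' (word [a] * p)"
proof (unfold homog_def, intro ballI allI)
  fix w b assume "w \<in> Poly_Mapping.keys (word [a] * p)"
  then have "w \<in> (#) a ` Poly_Mapping.keys p"
    by (rule subsetD[OF keys_Cons])
  then obtain w' where w: "w = a # w'" "w' \<in> Poly_Mapping.keys p"
    by (rule imageE)
  have "braid w b = braid [a] b * braid w' b"
    unfolding w(1) by (rule braid_Cons)
  also have "braid w' b = K b"
    using assms(1) w(2) unfolding homog_def by blast
  finally show "braid w b = K' b"
    by (simp only: assms(2))
qed

lemma homog_shuffle_word: "homog (\<lambda>b. braid u b * braid v b) (shuffle_word u v)"
proof (induction u v rule: shuffle_word.induct)
  case (3 a u c v)
  have "homog (\<lambda>b. braid (a # u) b * braid (c # v) b) (word [a] * shuffle_word u (c # v))"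
    by (rule homog_Cons[OF 3(1)]) (simp add: braid_Cons[of a u] mult.assoc)
  moreover have "homog (\<lambda>b. braid (a # u) b * braid (c # v) b) (word [c] * shuffle_word (a # u) v)"
    by (rule homog_Cons[OF 3(2)]) (simp add: braid_Cons[of c v] algebra_simps)
  ultimately show ?case
    unfolding shuffle_word_Cons by (intro homog_add homog_scale)
qed (simp_all add: homog_word)

lemma lin_ext_Cons: "lin_ext f (word [a] * p) = lin_ext (\<lambda>w. f (a # w)) p"
  by (induction p rule: free_alg_induct)
    (simp_all add: word_mult lin_ext_add lin_ext_scale distrib_left scale_mult_right)

lemma lin_ext_word_mult: "lin_ext (\<lambda>u. word b * f u) p = word b * lin_ext f p"
  by (rule lin_ext_comp[where F = "(*) (word b)", symmetric]) (simp_all add: distrib_left scale_mult_right)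

lemma shuffle_Cons_left:
  assumes "homog K p"
  shows "(word [a] * p) \<star> word (c # w)
    = word [a] * (p \<star> word (c # w)) + (braid [a] c * K c) *\<^sub>f (word [c] * ((word [a] * p) \<star> word w))"
proof -
  have "(word [a] * p) \<star> word (c # w) = lin_ext (\<lambda>u. shuffle_word (a # u) (c # w)) p"
    by (simp add: shuffle_def lin_ext_Cons)
  also have "\<dots> = lin_ext (\<lambda>u. word [a] * shuffle_word u (c # w)
      + (braid [a] c * K c) *\<^sub>f (word [c] * shuffle_word (a # u) w)) p"
  proof (rule lin_ext_cong)
    fix u assume "u \<in> Poly_Mapping.keys p"
    then have "braid (a # u) c = braid [a] c * K c"
      using assms braid_Cons[of a u c] by (simp add: homog_def)
    then show "shuffle_word (a # u) (c # w) = word [a] * shuffle_word u (c # w)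
      + (braid [a] c * K c) *\<^sub>f (word [c] * shuffle_word (a # u) w)"
      by (simp add: shuffle_word_Cons)
  qed
  also have "\<dots> = word [a] * (p \<star> word (c # w))
      + (braid [a] c * K c) *\<^sub>f (word [c] * ((word [a] * p) \<star> word w))"
    by (simp add: lin_ext_fun_add lin_ext_fun_scale shuffle_def lin_ext_Cons
        lin_ext_word_mult)
  finally show ?thesis .
qed

lemma shuffle_Cons_right:
  "word (a # u) \<star> (word [b] * p)
    = word [a] * (word u \<star> (word [b] * p)) + braid (a # u) b *\<^sub>f (word [b] * (word (a # u) \<star> p))"
  by (simp add: shuffle_def lin_ext_Cons shuffle_word_Cons lin_ext_fun_add lin_ext_fun_scale
      lin_ext_word_mult)

lemma shuffle_word_assoc: "(word u \<star> word v) \<star> word w = word u \<star> (word v \<star> word w)"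
proof (induction "length u + length v + length w" arbitrary: u v w rule: less_induct)
  case less
  show ?case
  proof (cases "u = [] \<or> v = [] \<or> w = []")
    case True
    then show ?thesis by (auto simp: word_Nil simp del: shuffle_word_word)
  next
    case False
    then obtain a u' b v' c w' where uvw: "u = a # u'" "v = b # v'" "w = c # w'"
      by (metis neq_Nil_conv)
    let ?k = "braid u c * braid v c"
    have uv: "word u \<star> word v = word [a] * (word u' \<star> word v) + braid u b *\<^sub>f (word [b] * (word u \<star> word v'))"
      by (simp add: uvw shuffle_word_Cons)
    have vw: "word v \<star> word w = word [b] * (word v' \<star> word w) + braid v c *\<^sub>f (word [c] * (word v \<star> word w'))"
      by (simp add: uvw shuffle_word_Cons)
    have 1: "(word [a] * (word u' \<star> word v)) \<star> word w
      = word [a] * ((word u' \<star> word v) \<star> word w)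
        + ?k *\<^sub>f (word [c] * ((word [a] * (word u' \<star> word v)) \<star> word w'))"
      using shuffle_Cons_left[OF homog_shuffle_word[of u' v], of a c w']
      by (simp add: uvw braid_Cons[of a u'] mult.assoc)
    have 2: "(word [b] * (word u \<star> word v')) \<star> word w
      = word [b] * ((word u \<star> word v') \<star> word w)
        + ?k *\<^sub>f (word [c] * ((word [b] * (word u \<star> word v')) \<star> word w'))"
      using shuffle_Cons_left[OF homog_shuffle_word[of u v'], of b c w']
      by (simp add: uvw braid_Cons[of b v'] mult.assoc mult.left_commute)
    have "(word u \<star> word v) \<star> word w
      = word [a] * ((word u' \<star> word v) \<star> word w)
        + braid u b *\<^sub>f (word [b] * ((word u \<star> word v') \<star> word w))
        + ?k *\<^sub>f (word [c] * ((word u \<star> word v) \<star> word w'))"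
      unfolding uv shuffle_add_left shuffle_scale_left 1 2
      by (simp add: scale_add_right scale_scale distrib_left scale_mult_right mult.commute add_ac
          mult.left_commute)
    also have "\<dots> = word [a] * (word u' \<star> (word v \<star> word w))
        + braid u b *\<^sub>f (word [b] * (word u \<star> (word v' \<star> word w)))
        + ?k *\<^sub>f (word [c] * (word u \<star> (word v \<star> word w')))"
      using less[of u' v w] less[of u v' w] less[of u v w'] by (simp add: uvw del: shuffle_word_word)
    also have "\<dots> = word u \<star> (word v \<star> word w)"
      unfolding vw shuffle_add_right shuffle_scale_right
      unfolding uvw(1) shuffle_Cons_right
      by (simp add: scale_add_right scale_scale distrib_left scale_mult_right mult.commute add_ac
          del: shuffle_word_word)
    finally show ?thesis .
  qed
qed

lemma shuffle_assoc: "(p \<star> r) \<star> s = p \<star> (r \<star> s)"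
proof (induction p rule: free_alg_induct)
  case (word u)
  show ?case
  proof (induction r rule: free_alg_induct)
    case (word v)
    show ?case
      by (induction s rule: free_alg_induct)
        (simp_all add: shuffle_word_assoc shuffle_add_right shuffle_scale_right del: shuffle_word_word)
  qed (simp_all add: shuffle_add_left shuffle_scale_left shuffle_add_right shuffle_scale_right)
qed (simp_all add: shuffle_add_left shuffle_scale_left)

fun phi_gen :: "gen \<Rightarrow> shuffle_alg"
  where
    "phi_gen GA = word [X]"
  | "phi_gen GB = word [Y]"

definition phi_free :: "gen free_alg \<Rightarrow> shuffle_alg"
  where "phi_free = lin_ext (\<lambda>w. foldr (\<lambda>g p. phi_gen g \<star> p) w 1)"

lemma phi_free_add: "phi_free (p + r) = phi_free p + phi_free r"
  and phi_free_scale: "phi_free (c *\<^sub>f p) = c *\<^sub>f phi_free p"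
  by (simp_all add: phi_free_def lin_ext_add lin_ext_scale)

lemma phi_free_word: "phi_free (word w) = foldr (\<lambda>g p. phi_gen g \<star> p) w 1"
  by (simp add: phi_free_def)

lemma phi_free_one: "phi_free 1 = 1"
  using phi_free_word[of "[]"] by (simp add: word_Nil)

lemma phi_free_diff: "phi_free (p - r) = phi_free p - phi_free r"
  using phi_free_add[of "p - r" r] by simp

lemma phi_free_mult: "phi_free (p * r) = phi_free p \<star> phi_free r"
proof (induction p rule: free_alg_induct)
  case (word u)
  show ?case
  proof (induction r rule: free_alg_induct)
    case (word v)
    show ?case
      by (induction u) (simp_all add: word_mult phi_free_word shuffle_assoc)
  qed (simp_all add: distrib_left scale_mult_right phi_free_add phi_free_scale
      shuffle_add_right shuffle_scale_right)
qed (simp_all add: distrib_right scale_mult_left phi_free_add phi_free_scale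
      shuffle_add_left shuffle_scale_left)

lemma braid_singleton:
  "braid [a] b = (if a = b then - (qvar powi 2) else - (qvar powi (-2)))"
  by (cases a; cases b) (simp_all add: braid_def)

lemma qint_3: "qint 3 = qvar powi 2 - 1 + qvar powi (-2)"
proof -
  define r where "r = inverse qvar"
  have r: "qvar * r = 1" using qvar_nonzero by (simp add: r_def)
  have "qint 3 = (r ^ 3 + qvar ^ 3) / (qvar + r)"
    by (simp add: qint_def r_def power_int_minus power_inverse power_int_numeral)
  also have "r ^ 3 + qvar ^ 3 = (qvar ^ 2 - 1 + r ^ 2) * (qvar + r)"
    using r by algebra
  also have "\<dots> / (qvar + r) = qvar ^ 2 - 1 + r ^ 2"
    using qvar_sum_nonzero by (simp add: r_def)
  finally show ?thesis
    by (simp add: r_def power_int_minus power_inverse power_int_numeral)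
qed

lemma shuffle_serre:
  assumes "a \<noteq> b"
  shows "word [a] \<star> (word [a] \<star> (word [a] \<star> word [b]))
      + qint 3 *\<^sub>f (word [a] \<star> (word [a] \<star> (word [b] \<star> word [a])))
      - qint 3 *\<^sub>f (word [a] \<star> (word [b] \<star> (word [a] \<star> word [a])))
      - word [b] \<star> (word [a] \<star> (word [a] \<star> word [a])) = 0"
proof -
  define Q where "Q = qvar powi 2"
  define P where "P = qvar powi (-2)"
  have PQ: "P * Q = 1"
    using qvar_nonzero by (simp add: P_def Q_def power_int_minus)
  have cancel: "P * Q = 1" "Q * P = 1" "P * (Q * z) = z" "Q * (P * z) = z" for z
    using PQ by (simp_all add: mult.commute flip: mult.assoc)
  note braid = braid_singleton[folded Q_def P_def]
  have W: "word [c] \<star> (d *\<^sub>f word w) = d *\<^sub>f shuffle_word [c] w" for c d w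
    by (simp add: shuffle_scale_right)
  show ?thesis
    using assms unfolding qint_3 Q_def[symmetric] P_def[symmetric]
    apply (simp add: shuffle_word_Cons braid shuffle_add_right W word_mult
        distrib_left scale_mult_right scale_add_right scale_scale)
    apply (rule poly_mapping_eqI)
    apply (simp add: lookup_add lookup_minus word_def lookup_single)
    subgoal for k
      apply (cases "k = [b,a,a,a]"; cases "k = [a,b,a,a]"; cases "k = [a,a,b,a]"; cases "k = [a,a,a,b]")
      apply (simp_all)
      apply (simp_all add: algebra_simps cancel)
      done
    done
qed

lemma phi_free_relator:
  assumes "r \<in> serre_relators"
  shows "phi_free r = 0"
proof -
  have gens: "phi_free fA = word [X]" "phi_free fB = word [Y]"
    by (simp_all add: fA_def fB_def phi_free_word)
  note serre = shuffle_serre[OF letter.distinct(1)] shuffle_serre[OF letter.distinct(2)]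
  from assms show ?thesis
    unfolding serre_relators_def insert_iff empty_iff
    by (elim disjE FalseE)
      (simp_all only: phi_free_add phi_free_diff phi_free_scale phi_free_mult shuffle_assoc gens serre
        power2_eq_square power3_eq_cube)
qed

lemma phi_free_ideal: "p \<in> serre_ideal \<Longrightarrow> phi_free p = 0"
proof (induction rule: serre_ideal.induct)
  case zero
  then show ?case by (simp add: phi_free_def)
next
  case (gen r a b)
  have "0 \<star> s = 0" "s \<star> 0 = 0" for s
    using shuffle_scale_left[of 0 0 s] shuffle_scale_right[of s 0 0] by simp_all
  then show ?case by (simp add: phi_free_mult phi_free_relator gen)
next
  case (add p p')
  then show ?case by (simp add: phi_free_add)
qed

text \<open>The parity on both sides is word length modulo 2, which the relators respect. So an algebra
  homomorphism for \<open>\<star>\<close> that maps the odd generators to the letters is automatically a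
  homomorphism of superalgebras. The facts \<open>phi_add\<close>, \<open>phi_scale\<close>, \<open>phi_one\<close>, \<open>phi_mult\<close>, \<open>phi_uA\<close> and
  \<open>phi_uB\<close> determine \<open>phi\<close> uniquely.\<close>

lift_definition phi :: "uq \<Rightarrow> shuffle_alg" is phi_free
  unfolding serre_eq_def using phi_free_ideal phi_free_diff by fastforce

lemma phi_add: "phi (a + b) = phi a + phi b"
  and phi_scale: "phi (c *\<^sub>u a) = c *\<^sub>f phi a"
  and phi_one: "phi 1 = 1"
  and phi_mult: "phi (a * b) = phi a \<star> phi b"
  by (transfer; simp add: phi_free_add phi_free_scale phi_free_one phi_free_mult)+

lemma phi_uA: "phi uA = word [X]"
  and phi_uB: "phi uB = word [Y]"
  by (transfer; simp add: fA_def fB_def phi_free_word)+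

fun bar :: "letter \<Rightarrow> int"
  where
    "bar X = 1"
  | "bar Y = -1"

definition Cat :: "nat \<Rightarrow> letter list set"
  where "Cat n = {w. length w = 2 * n \<and> sum_list (map bar w) = 0
    \<and> (\<forall>i\<in>{1..length w}. sum_list (map bar (take i w)) \<ge> 0)}"

lemma finite_Cat: "finite (Cat n)"
proof (rule finite_subset)
  have "w \<in> {w. set w \<subseteq> {X, Y} \<and> length w = 2 * n}" if "w \<in> Cat n" for w
    using that letter.exhaust by (auto simp: Cat_def)
  then show "Cat n \<subseteq> {w. set w \<subseteq> {X, Y} \<and> length w = 2 * n}" by blast
  show "finite {w. set w \<subseteq> {X, Y} \<and> length w = 2 * n}"
    by (rule finite_lists_length_eq) simp
qed

text \<open>\<open>Cs n w\<close> is the coefficient \<open>C\<^sup>s(w)\<close> for \<open>w \<in> Cat n\<close>.\<close>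

fun Cs :: "nat \<Rightarrow> letter list \<Rightarrow> ratfun"
  where
    "Cs 0 w = 1"
  | "Cs (Suc n) w = (\<Sum>v\<in>Cat n. Cs n v *
      (\<Sum>i \<in> {i \<in> {0..length v}. w = take i v @ [X] @ drop i v @ [Y]}.
        (-1) ^ i * qint (2 + 2 * sum_list (map bar (take i v)))))"

definition Cs_elem :: "nat \<Rightarrow> shuffle_alg"
  where "Cs_elem n = (\<Sum>w\<in>Cat n. Cs n w *\<^sub>f word w)"

end

theory Submission
  imports Defs
begin

text \<open>The proof takes place in the \<open>q\<close>-shuffle algebra and rests on \<^emph>\<open>right derivations\<close>. Deleting a
last letter \<open>b\<close> is a skew derivation of \<open>\<star>\<close> (\<open>rder_mult\<close>), and an element is determined by its
constant term and its two right derivatives (\<open>qshuf_eqI\<close>). So an identity between products can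
be verified by differentiating both sides until it closes up on itself.

  The source of all commutativity is the family of alternating words \<open>g\<^sub>n = (xy)\<^sup>n\<close> and
\<open>w\<^sub>n = (xy)\<^sup>n x\<close>. Their derivatives are again alternating, so a finite system of quadratic relations
can be proved by one induction (\<open>alt_relations\<close>); it says in particular that the \<open>g\<^sub>n\<close> commute,
and so do the \<open>w\<^sub>n\<close>. Put \<open>G(t) = \<Sum> g\<^sub>n t\<^sup>n\<close> and \<open>W(t) = \<Sum> w\<^sub>n t\<^sup>n\<close>. The theorem then
follows from three identities, with \<open>C(t) = \<Sum> C\<^sub>n t\<^sup>n\<close> the series of the Catalan elements, and
\<open>\<alpha> = q\<close>, \<open>\<beta> = - 1/q\<close>.

  \<^item> \<open>C(t) = G(\<alpha>t)\<^sup>-\<^sup>1 G(\<beta>t)\<^sup>-\<^sup>1\<close> (\<open>K_nth\<close>). The recursion for the weights says that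
    \<open>(q + 1/q) C\<^sub>n\<^sub>+\<^sub>1 = (q\<^sup>-\<^sup>2 C\<^sub>n \<star> x - q\<^sup>2 x \<star> C\<^sub>n) y\<close>, because the coefficient with which \<open>x\<close> enters
    a Catalan word in a shuffle depends only on the height there. This fixes the right derivatives
    of \<open>C(t)\<close>, and the right-hand side has the same ones.

  \<^item> \<open>\<Sum> x C\<^sub>n t\<^sup>n = G(\<alpha>t)\<^sup>-\<^sup>1 W(\<alpha>t) = W(\<beta>t) G(\<beta>t)\<^sup>-\<^sup>1\<close> (\<open>consx_K\<close>), hence
    \<open>t G'(t) G(t)\<^sup>-\<^sup>1 = \<Sum> {n} x C\<^sub>n\<^sub>-\<^sub>1 y t\<^sup>n\<close> (\<open>L_nth\<close>). The coefficient \<open>{n}\<close> appears as the difference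
    of the powers \<open>\<alpha>\<^sup>-\<^sup>n\<close> and \<open>\<beta>\<^sup>-\<^sup>n\<close> that relate the two forms of the first series.

  \<^item> Taking the logarithmic derivative of the product formula for \<open>C(t)\<close> and using
    \<open>(\<alpha>\<^sup>n + \<beta>\<^sup>n) {n} = (-1)\<^sup>n {2n}\<close> gives
    \<open>C(t) = exp (- \<Sum> (-1)\<^sup>n {2n}/n x C\<^sub>n\<^sub>-\<^sub>1 y t\<^sup>n)\<close> (\<open>exp_log_K\<close>).

On the side of \<open>U\<^sub>q\<^sup>+\<close>, comparing derivatives once more shows that the root vectors of \<open>n\<delta> + \<alpha>\<^sub>1\<close> go
to multiples of \<open>C\<^sub>n y\<close>, and those of \<open>n\<delta>\<close> to
\<open>- \<omega>\<^sup>n / (q + 1/q) C\<^sub>n\<close> with \<open>\<omega> = q\<^sup>-\<^sup>2 (q + 1/q)\<^sup>2\<close>. Hence the images of the Beck elements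
satisfy \<open>exp (- (q + 1/q) \<Sum> \<phi>(E\<^sub>n) t\<^sup>n) = C(\<omega>t)\<close>, and the exponential is injective on series
without constant term.\<close>

section \<open>The q-shuffle algebra as a ring\<close>

text \<open>A copy of the free algebra whose multiplication is \<open>\<star>\<close>, since the multiplication of the original type
is concatenation. As a ring it can serve as the coefficient ring of formal power series.\<close>

typedef qshuf = "UNIV :: shuffle_alg set"
  by simp

setup_lifting type_definition_qshuf

(* The coefficient field must stay opaque: otherwise lifting descends into the quotient
   construction of rational functions and of polynomials. *)
lifting_forget poly.lifting
lifting_forget fract.lifting
lifting_forget poly_mapping.lifting

lemma lookup_word: "Poly_Mapping.lookup (word w) v = (if v = w then 1 else 0)"
  by (simp add: word_def lookup_single when_def)

lemma lookup_shuffle_word_Nil: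
  "Poly_Mapping.lookup (shuffle_word u v) [] = (if u = [] \<and> v = [] then 1 else 0)"
proof (induction u v rule: shuffle_word.induct)
  case (3 a u c v)
  show ?case by (simp add: shuffle_word_Cons lookup_add lookup_mult_Nil) (simp add: word_def lookup_single)
qed (simp_all add: word_def lookup_single when_def)

lemma lookup_shuffle_Nil:
  "Poly_Mapping.lookup (p \<star> r) [] = Poly_Mapping.lookup p [] * Poly_Mapping.lookup r []"
proof (induction p rule: free_alg_induct)
  case (word u)
  show ?case
    by (induction r rule: free_alg_induct)
      (auto simp: shuffle_add_right shuffle_scale_right lookup_add distrib_left lookup_shuffle_word_Nil,
       auto simp: word_def lookup_single when_def)
qed (simp_all add: shuffle_add_left shuffle_scale_left lookup_add distrib_right)

instantiation qshuf :: ring_1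
begin

lift_definition zero_qshuf :: qshuf is 0 .
lift_definition one_qshuf :: qshuf is 1 .
lift_definition plus_qshuf :: "qshuf \<Rightarrow> qshuf \<Rightarrow> qshuf" is "(+)" .
lift_definition uminus_qshuf :: "qshuf \<Rightarrow> qshuf" is uminus .
lift_definition minus_qshuf :: "qshuf \<Rightarrow> qshuf \<Rightarrow> qshuf" is "(-)" .
lift_definition times_qshuf :: "qshuf \<Rightarrow> qshuf \<Rightarrow> qshuf" is shuffle .

instance
proof
  show "(0::qshuf) \<noteq> 1"
    by transfer simp
qed (transfer; simp add: algebra_simps shuffle_assoc shuffle_add_left shuffle_add_right)+

end

lift_definition scal :: "ratfun \<Rightarrow> qshuf \<Rightarrow> qshuf"  (infixr \<open>*\<^sub>s\<close> 75) is scale .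
lift_definition qword :: "letter list \<Rightarrow> qshuf" is word .
lift_definition cf :: "qshuf \<Rightarrow> letter list \<Rightarrow> ratfun" is Poly_Mapping.lookup .
lift_definition cons :: "letter \<Rightarrow> qshuf \<Rightarrow> qshuf" is "\<lambda>a p. word [a] * p" .
lift_definition snoc :: "qshuf \<Rightarrow> letter \<Rightarrow> qshuf" is "\<lambda>p a. p * word [a]" .

lemma qshuf_eq_iff: "p = r \<longleftrightarrow> (\<forall>w. cf p w = cf r w)"
  by transfer (auto intro: poly_mapping_eqI)

lemma cf_linear [simp]:
  "cf 0 w = 0" "cf (p + r) w = cf p w + cf r w" "cf (- p) w = - cf p w"
  "cf (p - r) w = cf p w - cf r w" "cf (c *\<^sub>s p) w = c * cf p w"
  by (transfer; simp add: lookup_add lookup_minus)+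

lemma cf_Nil_mult: "cf (p * r) [] = cf p [] * cf r []"
  by transfer (rule lookup_shuffle_Nil)

lemma cf_one: "cf 1 [] = 1"
  by transfer (simp add: lookup_one zero_list_def)

lemma cf_qword: "cf (qword w) v = (if v = w then 1 else 0)"
  by transfer (simp add: word_def lookup_single when_def)

lemma qword_Nil: "qword [] = 1"
  by transfer (rule word_Nil)

lemma scal_mult_left [simp]: "(c *\<^sub>s p) * r = c *\<^sub>s (p * r)"
  and scal_mult_right [simp]: "p * (c *\<^sub>s r) = c *\<^sub>s (p * r)"
  by (transfer; simp add: shuffle_scale_left shuffle_scale_right)+

lemma scal_simps [simp]:
  "0 *\<^sub>s p = 0" "1 *\<^sub>s p = p" "c *\<^sub>s (0 :: qshuf) = 0" "c *\<^sub>s (d *\<^sub>s p) = (c * d) *\<^sub>s p"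
  by (simp_all add: qshuf_eq_iff mult.assoc)

lemma scal_add_left: "(c + d) *\<^sub>s p = c *\<^sub>s p + d *\<^sub>s p"
  and scal_diff_left: "(c - d) *\<^sub>s p = c *\<^sub>s p - d *\<^sub>s p"
  and scal_add_right: "c *\<^sub>s (p + r) = c *\<^sub>s p + c *\<^sub>s r"
  and scal_diff_right: "c *\<^sub>s (p - r) = c *\<^sub>s p - c *\<^sub>s r"
  and scal_minus_right: "c *\<^sub>s (- p) = - (c *\<^sub>s p)"
  and scal_minus_left: "(- c) *\<^sub>s p = - (c *\<^sub>s p)"
  by (simp_all add: qshuf_eq_iff algebra_simps)

lemma scal_sum: "c *\<^sub>s (\<Sum>i\<in>I. f i) = (\<Sum>i\<in>I. c *\<^sub>s f i)"
  by (induction I rule: infinite_finite_induct) (simp_all add: scal_add_right)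

section \<open>Right derivations\<close>

definition rder_word :: "letter \<Rightarrow> letter list \<Rightarrow> shuffle_alg"
  where "rder_word b w = (if w \<noteq> [] \<and> last w = b then word (butlast w) else 0)"

lemma rder_word_Nil [simp]: "rder_word b [] = 0"
  by (simp add: rder_word_def)

lemma rder_word_Cons:
  "rder_word b (a # w) = (if w = [] then (if a = b then 1 else 0) else word [a] * rder_word b w)"
  by (simp add: rder_word_def word_mult word_Nil)

lift_definition rder :: "letter \<Rightarrow> qshuf \<Rightarrow> qshuf" is "\<lambda>b. lin_ext (rder_word b)" .

text \<open>The algebra automorphism that multiplies each word by the scalar for moving a letter \<open>b\<close> past it.
It measures how far deletion of \<open>b\<close> is from being an ordinary derivation.\<close>

lift_definition twist :: "letter \<Rightarrow> qshuf \<Rightarrow> qshuf"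
  is "\<lambda>b. lin_ext (\<lambda>w. braid w b *\<^sub>f word w)" .

lemma lookup_rder: "Poly_Mapping.lookup (lin_ext (rder_word b) p) w = Poly_Mapping.lookup p (w @ [b])"
proof (induction p rule: free_alg_induct)
  case (word v)
  show ?case
    by (cases v rule: rev_cases) (auto simp: rder_word_def lookup_word)
qed (simp_all add: lin_ext_add lin_ext_scale lookup_add)

lemma cf_rder: "cf (rder b p) w = cf p (w @ [b])"
  by transfer (rule lookup_rder)

text \<open>The principle behind all identities below: every nonempty word has a last letter, so nothing is lost
by passing to the constant term and the right derivatives.\<close>

lemma qshuf_eqI:
  assumes "cf p [] = cf r []" "\<And>b. rder b p = rder b r"
  shows "p = r"
proof -
  have "cf p w = cf r w" for w
    by (cases w rule: rev_cases) (use assms in \<open>auto simp flip: cf_rder\<close>)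
  then show ?thesis by (simp add: qshuf_eq_iff)
qed

lemma rder_Cons:
  "lin_ext (rder_word b) (word [a] * p)
    = word [a] * lin_ext (rder_word b) p + (if a = b then Poly_Mapping.lookup p [] else 0) *\<^sub>f 1"
proof (induction p rule: free_alg_induct)
  case (word w)
  show ?case by (simp add: word_mult rder_word_Cons lookup_word word_Nil lookup_one zero_list_def)
qed (simp_all add: lin_ext_add lin_ext_scale distrib_left scale_mult_right lookup_add scale_add_left
    scale_add_right scale_scale)

lemma shuffle_zero [simp]: "0 \<star> p = 0" "p \<star> 0 = 0"
  using shuffle_scale_left[of 0 0 p] shuffle_scale_right[of p 0 0] by simp_all

text \<open>The last letter of a shuffle of \<open>u\<close> and \<open>v\<close> comes from \<open>v\<close>, or from \<open>u\<close>, in which case it had to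
be moved past all of \<open>v\<close>.\<close>

lemma rder_shuffle_word:
  "lin_ext (rder_word b) (shuffle_word u v)
    = word u \<star> rder_word b v + braid v b *\<^sub>f (rder_word b u \<star> word v)"
proof (induction u v rule: shuffle_word.induct)
  case (3 a u c v)
  have R: "word [a] * (word u \<star> rder_word b (c # v))
      + braid (a # u) c *\<^sub>f (word [c] * (word (a # u) \<star> rder_word b v))
    = word (a # u) \<star> rder_word b (c # v)"
    by (cases "v = []")
      (auto simp: rder_word_Cons shuffle_Cons_right word_mult shuffle_scale_right simp del: shuffle_word_word)
  have L: "braid (c # v) b *\<^sub>f (word [a] * (rder_word b u \<star> word (c # v)))
      + (braid (a # u) c * braid v b) *\<^sub>f (word [c] * (rder_word b (a # u) \<star> word v))
    = braid (c # v) b *\<^sub>f (rder_word b (a # u) \<star> word (c # v))"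
  proof (cases u rule: rev_cases)
    case Nil
    then show ?thesis
      by (auto simp: rder_word_Cons word_mult braid_Cons[of c v] braid_singleton)
  next
    case (snoc u' d)
    have "braid [d] c = braid [c] d" by (simp add: braid_singleton)
    then have "braid (a # u' @ [d]) c * braid v d = braid (c # v) d * braid (a # u') c"
      using braid_append[of "a # u'" "[d]" c] braid_Cons[of c v d] by simp
    then show ?thesis
      by (auto simp: snoc rder_word_def word_mult shuffle_word_Cons scale_add_right scale_scale)
  qed
  show ?case
    unfolding R[symmetric] L[symmetric] shuffle_word_Cons lin_ext_add lin_ext_scale rder_Cons 3
    by (simp add: lookup_shuffle_word_Nil distrib_left scale_add_right scale_mult_right scale_scale
        add_ac del: shuffle_word_word)
qed (simp_all add: word_Nil)

lemma rder_shuffle: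
  "lin_ext (rder_word b) (p \<star> r)
    = p \<star> lin_ext (rder_word b) r
      + lin_ext (rder_word b) p \<star> lin_ext (\<lambda>w. braid w b *\<^sub>f word w) r"
proof (induction p rule: free_alg_induct)
  case (word u)
  show ?case
    by (induction r rule: free_alg_induct)
      (simp_all add: rder_shuffle_word shuffle_add_right shuffle_scale_right lin_ext_add lin_ext_scale
        scale_add_right)
qed (simp_all add: shuffle_add_left shuffle_scale_left lin_ext_add lin_ext_scale scale_add_right)

text \<open>All words of a shuffle have the letters of \<open>u\<close> and \<open>v\<close> together, so they share one scalar.\<close>

lemma twist_shuffle_word:
  "lin_ext (\<lambda>w. braid w b *\<^sub>f word w) (shuffle_word u v)
    = (braid u b * braid v b) *\<^sub>f shuffle_word u v"
proof -
  have "lin_ext (\<lambda>w. braid w b *\<^sub>f word w) p = K b *\<^sub>f p" if "homog K p" for K p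
  proof -
    have "lin_ext (\<lambda>w. braid w b *\<^sub>f word w) p = lin_ext (\<lambda>w. K b *\<^sub>f word w) p"
      using that by (intro lin_ext_cong) (simp add: homog_def)
    also have "\<dots> = K b *\<^sub>f lin_ext word p" by (rule lin_ext_fun_scale)
    also have "lin_ext word p = p"
      by (induction p rule: free_alg_induct) (simp_all add: lin_ext_add lin_ext_scale)
    finally show ?thesis .
  qed
  from this[OF homog_shuffle_word] show ?thesis .
qed

lemma twist_shuffle:
  "lin_ext (\<lambda>w. braid w b *\<^sub>f word w) (p \<star> r)
    = lin_ext (\<lambda>w. braid w b *\<^sub>f word w) p \<star> lin_ext (\<lambda>w. braid w b *\<^sub>f word w) r"
proof (induction p rule: free_alg_induct)
  case (word u)
  show ?case
    by (induction r rule: free_alg_induct)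
      (simp_all add: twist_shuffle_word shuffle_add_right shuffle_scale_right shuffle_scale_left
        lin_ext_add lin_ext_scale scale_scale mult.commute)
qed (simp_all add: shuffle_add_left shuffle_scale_left lin_ext_add lin_ext_scale)

lemma rder_mult: "rder b (p * r) = p * rder b r + rder b p * twist b r"
  by transfer (rule rder_shuffle)

lemma twist_mult: "twist b (p * r) = twist b p * twist b r"
  by transfer (rule twist_shuffle)

lemma lin_ext_diff: "lin_ext f (p - r) = lin_ext f p - lin_ext f r"
  using lin_ext_add[of f "p - r" r] by simp

lemma rder_linear [simp]:
  "rder b 0 = 0" "rder b (p + r) = rder b p + rder b r" "rder b (p - r) = rder b p - rder b r"
  "rder b (c *\<^sub>s p) = c *\<^sub>s rder b p"
  by (transfer; simp add: lin_ext_add lin_ext_diff lin_ext_scale)+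

lemma twist_linear [simp]:
  "twist b 0 = 0" "twist b (p + r) = twist b p + twist b r" "twist b (p - r) = twist b p - twist b r"
  "twist b (c *\<^sub>s p) = c *\<^sub>s twist b p"
  by (transfer; simp add: lin_ext_add lin_ext_diff lin_ext_scale)+

lemma rder_sum: "rder b (\<Sum>i\<in>I. f i) = (\<Sum>i\<in>I. rder b (f i))"
  by (induction I rule: infinite_finite_induct) simp_all

lemma twist_sum: "twist b (\<Sum>i\<in>I. f i) = (\<Sum>i\<in>I. twist b (f i))"
  by (induction I rule: infinite_finite_induct) simp_all

lemma rder_qword: "rder b (qword w) = (if w \<noteq> [] \<and> last w = b then qword (butlast w) else 0)"
  by transfer (simp add: rder_word_def)

lemma twist_qword: "twist b (qword w) = braid w b *\<^sub>s qword w"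
  by transfer simp

lemma rder_one [simp]: "rder b 1 = 0" and twist_one [simp]: "twist b 1 = 1"
  using rder_qword[of b "[]"] twist_qword[of b "[]"] by (simp_all add: qword_Nil)

lemma rder_snoc: "rder b (snoc p a) = (if a = b then p else 0)"
proof -
  have "lin_ext (rder_word b) (p * word [a]) = (if a = b then p else 0)" for p
    by (induction p rule: free_alg_induct)
      (simp_all add: word_mult rder_word_def lin_ext_add lin_ext_scale scale_mult_left distrib_right
        scale_add_right)
  then show ?thesis by transfer
qed

lemma rder_cons:
  "rder b (cons a p) = cons a (rder b p) + (if a = b then cf p [] else 0) *\<^sub>s 1"
  by transfer (rule rder_Cons)

lemma twist_snoc: "twist b (snoc p a) = braid [a] b *\<^sub>s snoc (twist b p) a"
proof -
  have "lin_ext (\<lambda>w. braid w b *\<^sub>f word w) (p * word [a])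
      = braid [a] b *\<^sub>f (lin_ext (\<lambda>w. braid w b *\<^sub>f word w) p * word [a])" for p
    by (induction p rule: free_alg_induct)
      (simp_all add: word_mult lin_ext_add lin_ext_scale scale_mult_left distrib_right
        scale_add_right scale_scale braid_append mult.commute)
  then show ?thesis by transfer
qed

lemma twist_cons: "twist b (cons a p) = braid [a] b *\<^sub>s cons a (twist b p)"
proof -
  have "lin_ext (\<lambda>w. braid w b *\<^sub>f word w) (word [a] * p)
      = braid [a] b *\<^sub>f (word [a] * lin_ext (\<lambda>w. braid w b *\<^sub>f word w) p)" for p
  proof (induction p rule: free_alg_induct)
    case (word w)
    show ?case using braid_Cons[of a w b] by (simp add: word_mult scale_mult_right scale_scale)
  qed (simp_all add: lin_ext_add lin_ext_scale scale_mult_right distrib_left scale_add_right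
      scale_scale mult.commute)
  then show ?thesis by transfer
qed

lemma cf_snoc_Nil: "cf (snoc p a) [] = 0" and cf_cons_Nil: "cf (cons a p) [] = 0"
  by (transfer; simp add: lookup_mult_Nil lookup_word)+

lemma cons_linear [simp]:
  "cons a 0 = 0" "cons a (p + r) = cons a p + cons a r" "cons a (p - r) = cons a p - cons a r"
  "cons a (- p) = - cons a p" "cons a (c *\<^sub>s p) = c *\<^sub>s cons a p"
  by (transfer; simp add: algebra_simps scale_mult_right)+

lemma cons_sum: "cons a (\<Sum>i\<in>I. f i) = (\<Sum>i\<in>I. cons a (f i))"
  by (induction I rule: infinite_finite_induct) simp_all

text \<open>The recursion for the first letter of a product. It is the mirror image of the rule for right
derivations, stated with prefixed letters; only these two rules enter the later computations.\<close>

lemma cons_mult_cons: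
  "cons a p * cons c r = cons a (p * cons c r) + cons c (twist c (cons a p) * r)"
proof -
  let ?t = "lin_ext (\<lambda>w. braid w c *\<^sub>f word w)"
  have "(word [a] * p) \<star> (word [c] * r)
    = word [a] * (p \<star> (word [c] * r)) + word [c] * (?t (word [a] * p) \<star> r)" for p r
  proof (induction p rule: free_alg_induct)
    case (word u)
    show ?case
      using shuffle_Cons_right[of a u c r]
      by (simp add: word_mult shuffle_scale_left scale_mult_right)
  qed (simp_all add: distrib_left shuffle_add_left shuffle_scale_left lin_ext_add lin_ext_scale
      scale_mult_right scale_add_right add_ac)
  then show ?thesis by transfer
qed

section \<open>The commuting alternating words\<close>

primrec altg :: "nat \<Rightarrow> qshuf"
  where
    "altg 0 = 1"
  | "altg (Suc n) = snoc (snoc (altg n) X) Y"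

definition altw :: "nat \<Rightarrow> qshuf"
  where "altw n = snoc (altg n) X"

lemma snoc_linear [simp]:
  "snoc 0 a = 0" "snoc (c *\<^sub>s p) a = c *\<^sub>s snoc p a" "snoc (p + r) a = snoc p a + snoc r a"
  by (transfer; simp add: scale_mult_left distrib_right)+

lemma qvar_mult_inverse [simp]: "qvar * inverse qvar = 1" "inverse qvar * qvar = 1"
  using qvar_nonzero by simp_all

lemma braid_letter:
  "braid [X] X = - (qvar\<^sup>2)" "braid [Y] Y = - (qvar\<^sup>2)"
  "braid [X] Y = - ((inverse qvar)\<^sup>2)" "braid [Y] X = - ((inverse qvar)\<^sup>2)"
  by (simp_all add: braid_singleton power_int_minus power_inverse)

lemma qvar_power2_cancel [simp]:
  "qvar\<^sup>2 * (inverse qvar)\<^sup>2 = 1" "(inverse qvar)\<^sup>2 * qvar\<^sup>2 = 1"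
  by (simp_all add: qvar_nonzero flip: power_mult_distrib)

lemma braid_XY: "braid [X] b * braid [Y] b = 1" "braid [Y] b * braid [X] b = 1"
  by (cases b; simp add: braid_letter)+

lemma altg_simps [simp]:
  "rder X (altg n) = 0" "rder Y (altg (Suc n)) = altw n" "twist b (altg n) = altg n"
  "rder X (altw n) = altg n" "rder Y (altw n) = 0" "twist b (altw n) = braid [X] b *\<^sub>s altw n"
  "cf (altg n) [] = (if n = 0 then 1 else 0)" "cf (altw n) [] = 0"
proof -
  show "rder X (altg n) = 0" by (cases n) (simp_all add: rder_snoc)
  show t: "twist b (altg n) = altg n"
    by (induction n) (simp_all add: twist_snoc braid_XY)
  show "twist b (altw n) = braid [X] b *\<^sub>s altw n"
    by (simp add: altw_def twist_snoc t)
  show "cf (altg n) [] = (if n = 0 then 1 else 0)" by (cases n) (simp_all add: cf_snoc_Nil cf_one)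
qed (simp_all add: altw_def rder_snoc cf_snoc_Nil)

text \<open>The four relations form a closed system under right derivation. The derivative of the first is the
second one degree lower; the second and third differentiate to the first in the same degree and to
the fourth one degree lower; the fourth differentiates to the third in the same degree.\<close>

lemma alt_relations:
  "(\<forall>i j. i + j = N \<longrightarrow> altg i * altg j = altg j * altg i)
    \<and> (\<forall>i j. Suc (i + j) = N \<longrightarrow>
        altw i * altg (Suc j) - altg (Suc j) * altw i = altw j * altg (Suc i) - altg (Suc i) * altw j)
    \<and> (\<forall>i j. i + j = N \<longrightarrow>
        altw i * altg j - altw j * altg i = qvar\<^sup>2 *\<^sub>s (altg i * altw j - altg j * altw i))
    \<and> (\<forall>i j. i + j = N \<longrightarrow> altw i * altw j = altw j * altw i)"
proof (induction N)
  case 0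
  show ?case by simp
next
  case (Suc N)
  have IHA: "altw i * altg (Suc j) - altg (Suc j) * altw i = altw j * altg (Suc i) - altg (Suc i) * altw j"
    if "Suc (i + j) = N" for i j
    using Suc.IH that by blast
  have IHB: "altw i * altw j = altw j * altw i" if "i + j = N" for i j
    using Suc.IH that by blast
  have G: "altg i * altg j = altg j * altg i" if "i + j = Suc N" for i j
  proof (cases "i = 0 \<or> j = 0")
    case False
    then obtain i' j' where ij: "i = Suc i'" "j = Suc j'"
      by (metis not0_implies_Suc)
    have Y: "altg i * altw j' + altw i' * altg j = altg j * altw i' + altw j' * altg i"
    proof -
      have "d + a = b + c" if "a - b = c - d" for a b c d :: qshuf
      proof -
        have "a = c - d + b" using that by (simp add: diff_eq_eq)
        then show ?thesis by simp
      qed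
      moreover have "altw i' * altg j - altg j * altw i' = altw j' * altg i - altg i * altw j'"
        using IHA[of i' j'] that unfolding ij by (simp del: altg.simps)
      ultimately show ?thesis .
    qed
    have "rder b (altg i * altg j) = rder b (altg j * altg i)" for b
    proof (cases b)
      case X
      then show ?thesis by (simp add: rder_mult)
    next
      case Y': Y
      have "rder Y (altg i) = altw i'" "rder Y (altg j) = altw j'"
        unfolding ij by (simp_all del: altg.simps)
      then show ?thesis unfolding Y' rder_mult altg_simps by (simp only: Y)
    qed
    then show ?thesis by (rule qshuf_eqI[rotated]) (simp add: cf_Nil_mult del: altg.simps)
  qed auto
  have A: "altw i * altg (Suc j) - altg (Suc j) * altw i = altw j * altg (Suc i) - altg (Suc i) * altw j"
    if "Suc (i + j) = Suc N" for i j
  proof (rule qshuf_eqI)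
    fix b
    have "altg i * altg (Suc j) - altg (Suc j) * altg i = 0"
      "altg j * altg (Suc i) - altg (Suc i) * altg j = 0"
      "altw i * altw j = altw j * altw i"
      using G[of i "Suc j"] G[of j "Suc i"] IHB[of i j] that by simp_all
    then show "rder b (altw i * altg (Suc j) - altg (Suc j) * altw i)
      = rder b (altw j * altg (Suc i) - altg (Suc i) * altw j)"
      by (cases b) (simp_all add: rder_mult braid_letter del: altg.simps)
  qed (simp add: cf_Nil_mult del: altg.simps)
  have C: "altw i * altg j - altw j * altg i = qvar\<^sup>2 *\<^sub>s (altg i * altw j - altg j * altw i)"
    if "i + j = Suc N" for i j
  proof (rule qshuf_eqI)
    fix b
    have comm: "altw i * rder Y (altg j) = rder Y (altg j) * altw i" if "i + j = Suc N" for i j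
      using IHB[of i "j - 1"] that by (cases j) (simp_all del: altg.simps(2))
    show "rder b (altw i * altg j - altw j * altg i)
      = rder b (qvar\<^sup>2 *\<^sub>s (altg i * altw j - altg j * altw i))"
    proof (cases b)
      case X
      then show ?thesis using G[of i j] that by (simp add: rder_mult braid_letter)
    next
      case Y
      show ?thesis
        using comm[of i j] comm[of j i] that
        by (simp add: Y rder_mult braid_letter scal_diff_right scal_minus_left scal_minus_right del: altg.simps)
    qed
  qed (simp add: cf_Nil_mult)
  have B: "altw i * altw j = altw j * altw i" if "i + j = Suc N" for i j
  proof (rule qshuf_eqI)
    fix b
    show "rder b (altw i * altw j) = rder b (altw j * altw i)"
    proof (cases b)
      case X
      have "altw i * altg j - qvar\<^sup>2 *\<^sub>s (altg i * altw j) = altw j * altg i - qvar\<^sup>2 *\<^sub>s (altg j * altw i)"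
        using C[OF that] unfolding scal_diff_right diff_eq_eq eq_diff_eq by (simp add: algebra_simps)
      then show ?thesis by (simp add: X rder_mult braid_letter scal_minus_left)
    next
      case Y
      then show ?thesis by (simp add: rder_mult)
    qed
  qed (simp add: cf_Nil_mult)
  show ?case using G A C B by blast
qed

lemma altg_commute: "altg i * altg j = altg j * altg i"
  and altw_commute: "altw i * altw j = altw j * altw i"
  using alt_relations by blast+

section \<open>Power series over the q-shuffle algebra\<close>

text \<open>Operations on series act on coefficients, except for \<open>shift\<close>, which multiplies by the
indeterminate \<open>t\<close>, \<open>resc a\<close>, which substitutes \<open>a t\<close> for \<open>t\<close>, and \<open>theta\<close>, which is \<open>t d/dt\<close>. The
operations \<open>dser\<close>, \<open>tser\<close> and \<open>cser\<close> are the right derivations, the twists and the constant terms.\<close>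

type_synonym ser = "qshuf fps"

definition smul :: "ratfun \<Rightarrow> ser \<Rightarrow> ser"  (infixr \<open>\<odot>\<close> 75)
  where "c \<odot> F = Abs_fps (\<lambda>n. c *\<^sub>s fps_nth F n)"
definition shift :: "ser \<Rightarrow> ser"
  where "shift F = Abs_fps (\<lambda>n. case n of 0 \<Rightarrow> 0 | Suc m \<Rightarrow> fps_nth F m)"
definition resc :: "ratfun \<Rightarrow> ser \<Rightarrow> ser"
  where "resc a F = Abs_fps (\<lambda>n. a ^ n *\<^sub>s fps_nth F n)"
definition theta :: "ser \<Rightarrow> ser"
  where "theta F = Abs_fps (\<lambda>n. of_nat n *\<^sub>s fps_nth F n)"
definition dser :: "letter \<Rightarrow> ser \<Rightarrow> ser"
  where "dser b F = Abs_fps (\<lambda>n. rder b (fps_nth F n))"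
definition tser :: "letter \<Rightarrow> ser \<Rightarrow> ser"
  where "tser b F = Abs_fps (\<lambda>n. twist b (fps_nth F n))"
definition cser :: "ser \<Rightarrow> ratfun fps"
  where "cser F = Abs_fps (\<lambda>n. cf (fps_nth F n) [])"

lemmas ser_defs = smul_def shift_def resc_def theta_def dser_def tser_def cser_def

lemma ser_nth [simp]:
  "fps_nth (c \<odot> F) n = c *\<^sub>s fps_nth F n"
  "fps_nth (shift F) 0 = 0" "fps_nth (shift F) (Suc n) = fps_nth F n"
  "fps_nth (resc a F) n = a ^ n *\<^sub>s fps_nth F n"
  "fps_nth (theta F) n = of_nat n *\<^sub>s fps_nth F n"
  "fps_nth (dser b F) n = rder b (fps_nth F n)"
  "fps_nth (tser b F) n = twist b (fps_nth F n)"
  "fps_nth (cser F) n = cf (fps_nth F n) []"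
  by (simp_all add: ser_defs)

text \<open>The series version of the determination principle. It reduces an identity between products of
series to identities between scalars, once the coefficients are known to commute.\<close>

lemma ser_eqI:
  assumes "cser F = cser G" "dser X F = dser X G" "dser Y F = dser Y G"
  shows "F = G"
proof (rule fps_ext)
  fix n
  show "fps_nth F n = fps_nth G n"
  proof (rule qshuf_eqI)
    show "cf (fps_nth F n) [] = cf (fps_nth G n) []"
      using arg_cong[OF assms(1), of "\<lambda>A. fps_nth A n"] by simp
    fix b show "rder b (fps_nth F n) = rder b (fps_nth G n)"
      using arg_cong[OF assms(2), of "\<lambda>A. fps_nth A n"] arg_cong[OF assms(3), of "\<lambda>A. fps_nth A n"]
      by (cases b) simp_all
  qed
qed

text \<open>The indeterminate is central, so shifts can be moved out of products.\<close>

lemma shift_conv: "shift F = fps_X * F"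
proof (rule fps_ext)
  fix n show "fps_nth (shift F) n = fps_nth (fps_X * F) n"
    by (cases n) simp_all
qed

lemma shift_mult [simp]: "shift F * G = shift (F * G)" "F * shift G = shift (F * G)"
proof -
  show "shift F * G = shift (F * G)" by (simp add: shift_conv mult.assoc)
  have "F * (fps_X * G) = fps_X * F * G" by (metis fps_mult_fps_X_commute mult.assoc)
  then show "F * shift G = shift (F * G)" by (simp add: shift_conv mult.assoc)
qed

lemma smul_mult [simp]: "(c \<odot> F) * G = c \<odot> (F * G)" "F * (c \<odot> G) = c \<odot> (F * G)"
  by (simp_all add: fps_eq_iff fps_mult_nth scal_sum)

lemma shift_smul [simp]: "shift (c \<odot> F) = c \<odot> shift F"
proof (rule fps_ext)
  fix n show "fps_nth (shift (c \<odot> F)) n = fps_nth (c \<odot> shift F) n"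
    by (cases n) simp_all
qed

lemma shift_linear [simp]:
  "shift 0 = 0" "shift (F + G) = shift F + shift G" "shift (F - G) = shift F - shift G"
  "shift (- F) = - shift F"
  by (simp_all add: shift_conv algebra_simps)

lemma smul_simps [simp]:
  "0 \<odot> F = 0" "1 \<odot> F = F" "c \<odot> (0 :: ser) = 0" "c \<odot> (d \<odot> F) = (c * d) \<odot> F"
  by (simp_all add: fps_eq_iff)

lemma smul_distrib:
  "(c + d) \<odot> F = c \<odot> F + d \<odot> F" "(c - d) \<odot> F = c \<odot> F - d \<odot> F"
  "c \<odot> (F + G) = c \<odot> F + c \<odot> G" "c \<odot> (F - G) = c \<odot> F - c \<odot> G"
  "c \<odot> (- F) = - (c \<odot> F)" "(- c) \<odot> F = - (c \<odot> F)"
  by (simp_all add: fps_eq_iff scal_add_left scal_diff_left scal_add_right scal_diff_right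
      scal_minus_left scal_minus_right)

lemma rder_uminus [simp]: "rder b (- p) = - rder b p" and twist_uminus [simp]: "twist b (- p) = - twist b p"
  using rder_linear(3)[of b 0 p] twist_linear(3)[of b 0 p] by simp_all

lemma dser_linear [simp]:
  "dser b 0 = 0" "dser b (F + G) = dser b F + dser b G" "dser b (F - G) = dser b F - dser b G"
  "dser b (- F) = - dser b F" "dser b (c \<odot> F) = c \<odot> dser b F" "dser b 1 = 0"
  by (simp_all add: fps_eq_iff)

lemma tser_linear [simp]:
  "tser b 0 = 0" "tser b (F + G) = tser b F + tser b G" "tser b (F - G) = tser b F - tser b G"
  "tser b (- F) = - tser b F" "tser b (c \<odot> F) = c \<odot> tser b F" "tser b 1 = 1"
  by (simp_all add: fps_eq_iff)

lemma dser_shift [simp]: "dser b (shift F) = shift (dser b F)"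
  and tser_shift [simp]: "tser b (shift F) = shift (tser b F)"
  by (auto simp: fps_eq_iff dser_def tser_def shift_def split: nat.splits)

lemma dser_mult: "dser b (F * G) = F * dser b G + dser b F * tser b G"
  by (simp add: fps_eq_iff fps_mult_nth rder_sum rder_mult sum.distrib)

lemma tser_mult: "tser b (F * G) = tser b F * tser b G"
  by (simp add: fps_eq_iff fps_mult_nth twist_sum twist_mult)

lemma cf_sum: "cf (\<Sum>i\<in>I. f i) w = (\<Sum>i\<in>I. cf (f i) w)"
  by (induction I rule: infinite_finite_induct) simp_all

lemma cser_simps [simp]:
  "cser 0 = 0" "cser 1 = 1" "cser (F + G) = cser F + cser G" "cser (F - G) = cser F - cser G"
  "cser (- F) = - cser F" "cser (c \<odot> F) = fps_const c * cser F"
  by (simp_all add: fps_eq_iff cf_one)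

lemma cser_mult [simp]: "cser (F * G) = cser F * cser G"
  by (simp add: fps_eq_iff fps_mult_nth cf_sum cf_Nil_mult)

lemma resc_mult: "resc a (F * G) = resc a F * resc a G"
proof (rule fps_ext)
  fix n
  have "a ^ n *\<^sub>s (fps_nth F i * fps_nth G (n - i))
      = a ^ i *\<^sub>s fps_nth F i * a ^ (n - i) *\<^sub>s fps_nth G (n - i)" if "i \<in> {0..n}" for i
    using that by (simp flip: power_add)
  then show "fps_nth (resc a (F * G)) n = fps_nth (resc a F * resc a G) n"
    by (simp add: fps_mult_nth scal_sum)
qed

lemma resc_one [simp]: "resc a 1 = 1"
  by (simp add: fps_eq_iff)

lemma resc_by_one [simp]: "resc 1 F = F"
  by (simp add: fps_eq_iff)

lemma theta_resc: "theta (resc a F) = resc a (theta F)"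
  by (simp add: fps_eq_iff mult.commute)

lemma dser_theta: "dser b (theta F) = theta (dser b F)"
  and tser_theta: "tser b (theta F) = theta (tser b F)"
  by (simp_all add: fps_eq_iff)

lemma theta_shift: "theta (shift F) = shift (F + theta F)"
proof (rule fps_ext)
  fix n show "fps_nth (theta (shift F)) n = fps_nth (shift (F + theta F)) n"
    by (cases n) (simp_all add: scal_add_left)
qed

text \<open>The Leibniz rule, from \<open>n = i + (n - i)\<close>.\<close>

lemma theta_mult: "theta (F * G) = theta F * G + F * theta G"
proof (rule fps_ext)
  fix n
  have "of_nat n *\<^sub>s (fps_nth F i * fps_nth G (n - i))
      = of_nat i *\<^sub>s (fps_nth F i * fps_nth G (n - i)) + of_nat (n - i) *\<^sub>s (fps_nth F i * fps_nth G (n - i))"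
    if "i \<in> {0..n}" for i
    using that by (simp flip: scal_add_left of_nat_add)
  then show "fps_nth (theta (F * G)) n = fps_nth (theta F * G + F * theta G) n"
    by (simp add: fps_mult_nth scal_sum flip: sum.distrib)
qed

lemma commute_series:
  fixes F G :: ser
  assumes "\<And>i j. fps_nth F i * fps_nth G j = fps_nth G j * fps_nth F i"
  shows "F * G = G * F"
proof (rule fps_ext)
  fix n
  have "fps_nth (F * G) n = (\<Sum>i=0..n. fps_nth G (n - i) * fps_nth F i)"
    by (simp add: fps_mult_nth assms)
  also have "\<dots> = fps_nth (G * F) n"
    unfolding fps_mult_nth by (rule sum.reindex_bij_witness[of _ "\<lambda>i. n - i" "\<lambda>i. n - i"]) auto
  finally show "fps_nth (F * G) n = fps_nth (G * F) n" .
qed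

lemma cser_shift [simp]: "cser (shift F) = fps_X * cser F"
proof (rule fps_ext)
  fix n show "fps_nth (cser (shift F)) n = fps_nth (fps_X * cser F) n"
    by (cases n) simp_all
qed

section \<open>Generating functions of the alternating words\<close>

definition G_ser :: ser where "G_ser = Abs_fps altg"
definition W_ser :: ser where "W_ser = Abs_fps altw"
definition G_inv :: ser where "G_inv = fps_right_inverse G_ser 1"
definition x_ser :: ser where "x_ser = fps_const (qword [X])"

lemma G_G_inv: "G_ser * G_inv = 1"
  unfolding G_inv_def by (rule fps_right_inverse) (simp add: G_ser_def)

lemma G_commute: "resc a G_ser * resc b G_ser = resc b G_ser * resc a G_ser"
  by (rule commute_series) (simp add: G_ser_def altg_commute mult.commute)

lemma G_inv_G: "G_inv * G_ser = 1"
proof -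
  have "fps_left_inverse G_ser 1 * G_ser = 1"
    by (rule fps_left_inverse) (simp add: G_ser_def)
  then show ?thesis by (metis G_G_inv mult.assoc mult.left_neutral mult.right_neutral)
qed

lemma W_commute: "resc a W_ser * resc b W_ser = resc b W_ser * resc a W_ser"
  by (rule commute_series) (simp add: W_ser_def altw_commute mult.commute)

lemma altw_0: "altw 0 = qword [X]"
  by (simp add: altw_def) (transfer, simp)

lemma x_W_commute: "x_ser * resc a W_ser = resc a W_ser * x_ser"
  unfolding x_ser_def altw_0[symmetric] by (rule commute_series) (auto simp: W_ser_def altw_commute)

lemma G_der [simp]:
  "dser X (resc a G_ser) = 0" "dser Y (resc a G_ser) = a \<odot> shift (resc a W_ser)" "tser b (resc a G_ser) = resc a G_ser"
  "cser (resc a G_ser) = 1"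
proof -
  show "dser Y (resc a G_ser) = a \<odot> shift (resc a W_ser)"
  proof (rule fps_ext)
    fix n show "fps_nth (dser Y (resc a G_ser)) n = fps_nth (a \<odot> shift (resc a W_ser)) n"
      by (cases n) (simp_all add: G_ser_def W_ser_def del: altg.simps(2))
  qed
qed (simp_all add: fps_eq_iff G_ser_def)

lemma W_der [simp]:
  "dser X (resc a W_ser) = resc a G_ser" "dser Y (resc a W_ser) = 0" "tser b (resc a W_ser) = braid [X] b \<odot> resc a W_ser"
  "cser (resc a W_ser) = 0"
  by (simp_all add: fps_eq_iff G_ser_def W_ser_def mult.commute)

lemma x_der [simp]: "dser X x_ser = 1" "dser Y x_ser = 0" "tser b x_ser = braid [X] b \<odot> x_ser" "cser x_ser = 0"
  by (auto simp: fps_eq_iff x_ser_def rder_qword twist_qword qword_Nil cf_qword)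

lemma G_inv_inverse: "resc a G_ser * resc a G_inv = 1" "resc a G_inv * resc a G_ser = 1"
  by (simp_all add: G_G_inv G_inv_G flip: resc_mult)

text \<open>The derivative of an inverse, from the Leibniz rule for \<open>G(at) G(at)\<^sup>-\<^sup>1 = 1\<close>; the twist of \<open>G\<close> is
trivial since its words contain both letters equally often.\<close>

lemma G_inv_der_general:
  "tser b (resc a G_inv) = resc a G_inv" "dser b (resc a G_inv) = - (resc a G_inv * dser b (resc a G_ser) * resc a G_inv)"
proof -
  let ?G_ser = "resc a G_ser" and ?G_inv = "resc a G_inv"
  have inv: "F = ?G_inv * F'" if "?G_ser * F = F'" for F F'
    using that by (metis G_inv_inverse(2) mult.assoc mult.left_neutral)
  have "?G_ser * tser b ?G_inv = 1"
    using arg_cong[OF G_inv_inverse(1)[of a], of "tser b"] by (simp add: tser_mult)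
  then show t: "tser b ?G_inv = ?G_inv" using inv by fastforce
  have "?G_ser * dser b ?G_inv = - (dser b ?G_ser * ?G_inv)"
    using arg_cong[OF G_inv_inverse(1)[of a], of "dser b"]
    by (simp add: dser_mult t add_eq_0_iff2)
  from inv[OF this] show "dser b ?G_inv = - (?G_inv * dser b ?G_ser * ?G_inv)"
    by (simp add: mult.assoc)
qed

lemma cser_G_inv [simp]: "cser (resc a G_inv) = 1"
  using arg_cong[OF G_inv_inverse(1)[of a], of cser] by simp

lemma G_inv_der [simp]:
  "dser X (resc a G_inv) = 0" "dser Y (resc a G_inv) = - a \<odot> shift (resc a G_inv * resc a W_ser * resc a G_inv)"
  "tser b (resc a G_inv) = resc a G_inv"
  by (simp_all add: G_inv_der_general smul_distrib)

lemma commute_G_inv: "F * resc a G_ser = resc a G_ser * F \<Longrightarrow> F * resc a G_inv = resc a G_inv * F"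
  by (metis G_inv_inverse mult.assoc mult.left_neutral mult.right_neutral)

lemma G_inv_commute: "resc a G_ser * resc b G_inv = resc b G_inv * resc a G_ser"
  "resc a G_inv * resc b G_inv = resc b G_inv * resc a G_inv"
  using commute_G_inv G_commute by metis+

text \<open>The two scales at which the alternating series enters the Catalan series. They are the roots of
\<open>z\<^sup>2 - (q - 1/q) z - 1\<close>; this is what the recursion for the Catalan series forces.\<close>

abbreviation (input) "\<alpha> \<equiv> qvar"
abbreviation (input) "\<beta> \<equiv> - inverse qvar"

text \<open>Linear identities over atomic products become identities in the field of rational functions when read
off coefficient by coefficient.\<close>

lemma ser_eq_iff: "F = F' \<longleftrightarrow> (\<forall>n w. cf (fps_nth F n) w = cf (fps_nth F' n) w)" for F F' :: ser
  by (simp add: fps_eq_iff qshuf_eq_iff)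

text \<open>The derivatives by \<open>x\<close> agree because the \<open>g\<^sub>n\<close> commute. Those by \<open>y\<close> are multiples of the product
of the two series of \<open>w\<^sub>n\<close>, with factors \<open>\<beta>\<close> and \<open>- q\<^sup>-\<^sup>2 \<alpha>\<close>, which agree for these two scales.\<close>

lemma W_G_swap: "resc \<alpha> W_ser * resc \<beta> G_ser = resc \<alpha> G_ser * resc \<beta> W_ser"
  by (rule ser_eqI; simp add: dser_mult braid_letter; simp add: ser_eq_iff field_simps power2_eq_square qvar_nonzero)

text \<open>Together with the preceding identity this expresses all four products of one \<open>G\<close> and one \<open>W\<close>, at the
scales \<open>\<alpha>\<close> and \<open>\<beta>\<close> in some order, through two of them. For the \<open>y\<close>-derivatives it amounts to
\<open>\<alpha> = - q\<^sup>2 \<beta>\<close>.\<close>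

lemma W_G_expand: "resc \<beta> W_ser * resc \<alpha> G_ser
    = (qvar\<^sup>2) \<odot> (resc \<beta> G_ser * resc \<alpha> W_ser) + (1 - qvar\<^sup>2) \<odot> (resc \<alpha> W_ser * resc \<beta> G_ser)"
  by (rule ser_eqI; simp add: dser_mult braid_letter G_commute[of \<beta> \<alpha>] W_commute[of \<beta> \<alpha>];
      simp add: ser_eq_iff field_simps power2_eq_square qvar_nonzero)

text \<open>The \<open>y\<close>-derivatives on the left cancel because \<open>x\<close> commutes with every \<open>w\<^sub>n\<close>.\<close>

lemma x_G_relation: "x_ser * resc a G_ser + qvar\<^sup>2 \<odot> (resc a G_ser * x_ser) = (1 + qvar\<^sup>2) \<odot> resc a W_ser"
  by (rule ser_eqI; simp add: dser_mult braid_letter smul_distrib x_W_commute;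
      simp add: ser_eq_iff field_simps power2_eq_square qvar_nonzero)

text \<open>Moving \<open>x\<close> past the two factors one after the other; the swap identity collects the two leftover
terms into a single product.\<close>

lemma x_GG_relation: "x_ser * (resc \<alpha> G_ser * resc \<beta> G_ser) - qvar ^ 4 \<odot> (resc \<alpha> G_ser * resc \<beta> G_ser * x_ser)
    = (1 - qvar ^ 4) \<odot> (resc \<alpha> W_ser * resc \<beta> G_ser)"
proof -
  have xG: "x_ser * resc a G_ser = (1 + qvar\<^sup>2) \<odot> resc a W_ser - qvar\<^sup>2 \<odot> (resc a G_ser * x_ser)" for a
    using x_G_relation[of a] by (simp add: eq_diff_eq)
  have "x_ser * (resc \<alpha> G_ser * resc \<beta> G_ser) = (x_ser * resc \<alpha> G_ser) * resc \<beta> G_ser"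
    by (simp add: mult.assoc)
  also have "\<dots> = (1 + qvar\<^sup>2) \<odot> (resc \<alpha> W_ser * resc \<beta> G_ser) - qvar\<^sup>2 \<odot> (resc \<alpha> G_ser * (x_ser * resc \<beta> G_ser))"
    unfolding xG[of \<alpha>] by (simp add: left_diff_distrib mult.assoc)
  also have "\<dots> = (1 + qvar\<^sup>2) \<odot> (resc \<alpha> W_ser * resc \<beta> G_ser)
      - qvar\<^sup>2 \<odot> ((1 + qvar\<^sup>2) \<odot> (resc \<alpha> W_ser * resc \<beta> G_ser) - qvar\<^sup>2 \<odot> (resc \<alpha> G_ser * resc \<beta> G_ser * x_ser))"
    unfolding xG[of \<beta>] by (simp add: right_diff_distrib mult.assoc W_G_swap)
  finally show ?thesis
    by (simp add: ser_eq_iff algebra_simps power4_eq_xxxx power2_eq_square)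
qed

text \<open>\<open>K_ser\<close> will turn out to be the generating series of the Catalan elements. \<open>WG_ser\<close> is the product
through which its derivative is expressed.\<close>

definition K_ser :: ser where "K_ser = resc \<alpha> G_inv * resc \<beta> G_inv"
definition WG_ser :: ser where "WG_ser = resc \<alpha> W_ser * resc \<beta> G_ser"

lemma K_G_G: "K_ser * (resc \<alpha> G_ser * resc \<beta> G_ser) = 1" "(resc \<alpha> G_ser * resc \<beta> G_ser) * K_ser = 1"
  unfolding K_ser_def by (metis G_inv_inverse G_inv_commute(2) mult.assoc mult.right_neutral)+

lemma K_G: "resc \<alpha> G_ser * K_ser = resc \<beta> G_inv" "K_ser * resc \<beta> G_ser = resc \<alpha> G_inv"
  unfolding K_ser_def by (metis G_inv_inverse mult.assoc mult.left_neutral mult.right_neutral)+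

lemma K_der_via_WG: "dser Y K_ser = (inverse qvar - qvar) \<odot> shift (K_ser * WG_ser * K_ser)"
proof -
  have 1: "resc \<alpha> G_inv * resc \<beta> G_inv * resc \<beta> W_ser * resc \<beta> G_inv = K_ser * (resc \<beta> W_ser * resc \<alpha> G_ser) * K_ser"
    by (simp add: mult.assoc K_G) (simp add: K_ser_def mult.assoc)
  have 2: "resc \<alpha> G_inv * resc \<alpha> W_ser * resc \<alpha> G_inv * resc \<beta> G_inv = K_ser * (resc \<beta> G_ser * resc \<alpha> W_ser) * K_ser"
    by (simp add: K_G flip: mult.assoc) (simp add: K_ser_def mult.assoc)
  have "dser Y K_ser = inverse qvar \<odot> shift (resc \<alpha> G_inv * resc \<beta> G_inv * resc \<beta> W_ser * resc \<beta> G_inv)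
      - qvar \<odot> shift (resc \<alpha> G_inv * resc \<alpha> W_ser * resc \<alpha> G_inv * resc \<beta> G_inv)"
    unfolding K_ser_def by (simp add: dser_mult smul_distrib mult.assoc)
  also have "\<dots> = (inverse qvar - qvar) \<odot> shift (K_ser * WG_ser * K_ser)"
    unfolding 1 2 W_G_expand WG_ser_def
    by (simp add: distrib_left distrib_right; simp add: ser_eq_iff field_simps power2_eq_square qvar_nonzero)
  finally show ?thesis .
qed

text \<open>Multiplying the relation for moving \<open>x\<close> past \<open>G(\<alpha>t) G(\<beta>t)\<close> by the inverse \<open>K_ser\<close> on both sides turns
it into the relation that characterises the Catalan series.\<close>

lemma K_der:
  "dser X K_ser = 0" "tser b K_ser = K_ser" "cser K_ser = 1"
  "(qvar + inverse qvar) \<odot> dser Y K_ser = (inverse qvar)\<^sup>2 \<odot> shift (K_ser * x_ser) - qvar\<^sup>2 \<odot> shift (x_ser * K_ser)"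
proof -
  show "dser X K_ser = 0" "tser b K_ser = K_ser" "cser K_ser = 1"
    by (simp_all add: K_ser_def dser_mult tser_mult)
  have "K_ser * (x_ser * (resc \<alpha> G_ser * resc \<beta> G_ser) - qvar ^ 4 \<odot> (resc \<alpha> G_ser * resc \<beta> G_ser * x_ser)) * K_ser
    = (1 - qvar ^ 4) \<odot> (K_ser * WG_ser * K_ser)"
    unfolding x_GG_relation WG_ser_def by simp
  moreover have "K_ser * (x_ser * (resc \<alpha> G_ser * resc \<beta> G_ser) - qvar ^ 4 \<odot> (resc \<alpha> G_ser * resc \<beta> G_ser * x_ser)) * K_ser
    = K_ser * x_ser - qvar ^ 4 \<odot> (x_ser * K_ser)"
  proof -
    have "K_ser * (x_ser * (resc \<alpha> G_ser * resc \<beta> G_ser)) * K_ser = K_ser * x_ser * ((resc \<alpha> G_ser * resc \<beta> G_ser) * K_ser)"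
      by (simp only: mult.assoc)
    moreover have "K_ser * (resc \<alpha> G_ser * resc \<beta> G_ser * x_ser) * K_ser = (K_ser * (resc \<alpha> G_ser * resc \<beta> G_ser)) * x_ser * K_ser"
      by (simp only: mult.assoc)
    ultimately show ?thesis
      by (simp add: K_G_G right_diff_distrib left_diff_distrib)
  qed
  ultimately have "(1 - qvar ^ 4) \<odot> (K_ser * WG_ser * K_ser) = K_ser * x_ser - qvar ^ 4 \<odot> (x_ser * K_ser)"
    by simp
  then have "(inverse qvar)\<^sup>2 \<odot> shift ((1 - qvar ^ 4) \<odot> (K_ser * WG_ser * K_ser))
      = (inverse qvar)\<^sup>2 \<odot> shift (K_ser * x_ser - qvar ^ 4 \<odot> (x_ser * K_ser))"
    by simp
  then show "(qvar + inverse qvar) \<odot> dser Y K_ser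
      = (inverse qvar)\<^sup>2 \<odot> shift (K_ser * x_ser) - qvar\<^sup>2 \<odot> shift (x_ser * K_ser)"
    unfolding K_der_via_WG
    by (simp add: ser_eq_iff; simp add: field_simps power4_eq_xxxx power2_eq_square qvar_nonzero)
qed

section \<open>Catalan words with an additional first letter\<close>

definition consx :: "ser \<Rightarrow> ser"
  where "consx F = Abs_fps (\<lambda>n. cons X (fps_nth F n))"

lemma consx_nth [simp]: "fps_nth (consx F) n = cons X (fps_nth F n)"
  by (simp add: consx_def)

text \<open>The scalar \<open>- q\<^sup>2\<close> is that of the second prefixed \<open>x\<close> moving past the first one; the
assumption says that the rest of the first factor contributes none.\<close>

lemma consx_mult_consx:
  assumes "tser X F = F"
  shows "consx F * consx F' = consx (F * consx F' - qvar\<^sup>2 \<odot> (consx F * F'))"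
proof -
  have "twist X (fps_nth F n) = fps_nth F n" for n
    using arg_cong[OF assms, of "\<lambda>A. fps_nth A n"] by simp
  then show ?thesis
    by (simp add: fps_eq_iff fps_mult_nth cons_mult_cons twist_cons braid_letter cons_sum scal_sum
        sum_subtractf scal_minus_left)
qed

text \<open>The first conclusion evaluates the right-hand side of the product rule for series with a prefixed \<open>x\<close>,
with \<open>G(\<alpha>t)\<^sup>-\<^sup>1 W(\<alpha>t)\<close> in place of the prefixed Catalan series.\<close>

lemma K_X_relation: "K_ser * (resc \<alpha> G_inv * resc \<alpha> W_ser) - qvar\<^sup>2 \<odot> ((resc \<alpha> G_inv * resc \<alpha> W_ser) * K_ser) = (1 - qvar\<^sup>2) \<odot> (K_ser * WG_ser * K_ser)"
  and G_inv_W_swap: "resc \<alpha> G_inv * resc \<alpha> W_ser = resc \<beta> W_ser * resc \<beta> G_inv"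
proof -
  have "resc \<alpha> G_inv * (resc \<alpha> W_ser * resc \<beta> G_ser) * resc \<beta> G_inv = resc \<alpha> G_inv * resc \<alpha> W_ser * (resc \<beta> G_ser * resc \<beta> G_inv)"
    by (simp only: mult.assoc)
  moreover have "resc \<alpha> G_inv * (resc \<alpha> G_ser * resc \<beta> W_ser) * resc \<beta> G_inv = (resc \<alpha> G_inv * resc \<alpha> G_ser) * resc \<beta> W_ser * resc \<beta> G_inv"
    by (simp only: mult.assoc)
  ultimately show *: "resc \<alpha> G_inv * resc \<alpha> W_ser = resc \<beta> W_ser * resc \<beta> G_inv"
    by (simp add: W_G_swap G_inv_inverse)
  have 1: "K_ser * (resc \<alpha> G_inv * resc \<alpha> W_ser) = K_ser * (resc \<beta> W_ser * resc \<alpha> G_ser) * K_ser"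
    unfolding * by (simp add: mult.assoc K_G)
  have 2: "resc \<alpha> G_inv * resc \<alpha> W_ser * K_ser = K_ser * (resc \<beta> G_ser * resc \<alpha> W_ser) * K_ser"
    by (simp add: K_G flip: mult.assoc)
  show "K_ser * (resc \<alpha> G_inv * resc \<alpha> W_ser) - qvar\<^sup>2 \<odot> ((resc \<alpha> G_inv * resc \<alpha> W_ser) * K_ser) = (1 - qvar\<^sup>2) \<odot> (K_ser * WG_ser * K_ser)"
    unfolding 1 2 W_G_expand WG_ser_def
    by (simp add: distrib_left distrib_right)
qed

text \<open>A Riccati equation: with the constant term and the \<open>x\<close>-derivative, it determines the series recursively.\<close>

lemma G_inv_W_der: "dser X (resc \<alpha> G_inv * resc \<alpha> W_ser) = 1"
  "dser Y (resc \<alpha> G_inv * resc \<alpha> W_ser) = inverse qvar \<odot> shift ((resc \<alpha> G_inv * resc \<alpha> W_ser) * (resc \<alpha> G_inv * resc \<alpha> W_ser))"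
  unfolding G_inv_W_swap by (simp_all add: dser_mult G_inv_inverse smul_distrib mult.assoc)

text \<open>The series with a prefixed \<open>x\<close> satisfies the same Riccati equation. Its derivative is known
from \<open>K_der_via_WG\<close>; that this equals \<open>q\<^sup>-\<^sup>1 t\<close> times its square uses the claim itself in lower
degrees, so the proof is by induction on the degree.\<close>

lemma consx_K: "consx K_ser = resc \<alpha> G_inv * resc \<alpha> W_ser" (is "_ = ?X")
proof -
  have cfK: "cf (fps_nth K_ser n) [] = (if n = 0 then 1 else 0)" for n
    using arg_cong[OF K_der(3), of "\<lambda>A. fps_nth A n"] by simp
  have dK: "rder X (fps_nth K_ser n) = 0" for n
    using arg_cong[OF K_der(1), of "\<lambda>A. fps_nth A n"] by simp
  have cX: "cf (fps_nth ?X n) [] = 0" for n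
  proof -
    have "cser ?X = 0" by simp
    then show ?thesis by (metis ser_nth(8) fps_zero_nth)
  qed
  have dX: "rder X (fps_nth ?X n) = (if n = 0 then 1 else 0)" for n
    using arg_cong[OF G_inv_W_der(1), of "\<lambda>A. fps_nth A n"] by simp
  have "fps_nth (consx K_ser) n = fps_nth ?X n" for n
  proof (induction n rule: less_induct)
    case (less n)
    have "rder Y (fps_nth (consx K_ser) n) = rder Y (fps_nth ?X n)"
    proof (cases n)
      case 0
      have "dser Y K_ser = shift ((inverse qvar - qvar) \<odot> (K_ser * WG_ser * K_ser))" "dser Y ?X = shift (inverse qvar \<odot> (?X * ?X))"
        by (simp_all add: K_der_via_WG G_inv_W_der)
      then have "fps_nth (dser Y K_ser) 0 = 0" "fps_nth (dser Y ?X) 0 = 0" by simp_all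
      then show ?thesis by (simp add: 0 rder_cons)
    next
      case (Suc m)
      have IH: "fps_nth (consx K_ser) i = fps_nth ?X i" if "i \<le> m" for i
        using less that Suc by simp
      have cong: "fps_nth (F * consx K_ser) m = fps_nth (F * ?X) m"
        "fps_nth (consx K_ser * F) m = fps_nth (?X * F) m" for F
        using IH by (auto simp: fps_mult_nth intro!: sum.cong)
      have "fps_nth (?X * ?X) m = fps_nth (consx K_ser * consx K_ser) m"
        by (metis cong)
      also have "\<dots> = cons X (fps_nth (K_ser * consx K_ser - qvar\<^sup>2 \<odot> (consx K_ser * K_ser)) m)"
        by (simp add: consx_mult_consx[OF K_der(2)])
      also have "\<dots> = cons X (fps_nth (K_ser * ?X - qvar\<^sup>2 \<odot> (?X * K_ser)) m)"
        by (simp only: fps_sub_nth ser_nth cong)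
      finally have XX: "fps_nth (?X * ?X) m = (1 - qvar\<^sup>2) *\<^sub>s cons X (fps_nth (K_ser * WG_ser * K_ser) m)"
        unfolding K_X_relation by simp
      have "rder Y (fps_nth (consx K_ser) n) = cons X (fps_nth (dser Y K_ser) n)"
        by (simp add: rder_cons)
      also have "\<dots> = (inverse qvar - qvar) *\<^sub>s cons X (fps_nth (K_ser * WG_ser * K_ser) m)"
        unfolding K_der_via_WG Suc by simp
      also have "\<dots> = inverse qvar *\<^sub>s fps_nth (?X * ?X) m"
        unfolding XX by (simp add: right_diff_distrib power2_eq_square qvar_nonzero flip: mult.assoc)
      also have "\<dots> = fps_nth (dser Y ?X) n"
        unfolding G_inv_W_der Suc by simp
      finally show ?thesis by simp
    qed
    then have "rder b (fps_nth (consx K_ser) n) = rder b (fps_nth ?X n)" for b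
      by (cases b) (simp_all add: rder_cons cfK dK dX)
    then show ?case
      by (rule qshuf_eqI[rotated]) (simp add: cX cf_cons_Nil)
  qed
  then show ?thesis by (simp add: fps_eq_iff)
qed

section \<open>The logarithmic derivative of the alternating series\<close>

text \<open>Commutation of all coefficients is stronger than commutation of the series and, unlike it, survives
operations on single coefficients such as rescaling and differentiation with respect to \<open>t\<close>.\<close>

definition coeff_commute :: "ser \<Rightarrow> ser \<Rightarrow> bool"
  where "coeff_commute F F' \<longleftrightarrow> (\<forall>i j. fps_nth F i * fps_nth F' j = fps_nth F' j * fps_nth F i)"

lemma coeff_commute_sym: "coeff_commute F F' \<Longrightarrow> coeff_commute F' F"
  by (simp add: coeff_commute_def)

lemma coeff_commuteD: "coeff_commute F F' \<Longrightarrow> F * F' = F' * F"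
  unfolding coeff_commute_def by (rule commute_series) simp

lemma coeff_commute_termwise:
  assumes "coeff_commute F F'" "\<And>n. fps_nth F'' n = c n *\<^sub>s fps_nth F' n"
  shows "coeff_commute F F''"
  using assms by (simp add: coeff_commute_def)

lemma coeff_commute_mult:
  assumes "coeff_commute F A" "coeff_commute F B"
  shows "coeff_commute F (A * B)"
proof -
  have "fps_nth F i * (fps_nth A k * fps_nth B l) = fps_nth A k * fps_nth B l * fps_nth F i" for i k l
    using assms unfolding coeff_commute_def by (metis mult.assoc)
  then show ?thesis
    by (simp add: coeff_commute_def fps_mult_nth sum_distrib_left sum_distrib_right)
qed

text \<open>An element that commutes with all coefficients of \<open>G\<close>, viewed as a constant series, commutes with \<open>G\<close>
and so with its inverse.\<close>

lemma coeff_commute_G_inv: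
  assumes "coeff_commute F G_ser"
  shows "coeff_commute F G_inv"
  unfolding coeff_commute_def
proof (intro allI)
  fix i j
  have "fps_const (fps_nth F i) * G_ser = G_ser * fps_const (fps_nth F i)"
    using assms by (simp add: fps_eq_iff coeff_commute_def)
  then have "fps_const (fps_nth F i) * G_inv = G_inv * fps_const (fps_nth F i)"
    using commute_G_inv[of "fps_const (fps_nth F i)" 1] by simp
  from arg_cong[OF this, of "\<lambda>A. fps_nth A j"]
  show "fps_nth F i * fps_nth G_inv j = fps_nth G_inv j * fps_nth F i" by simp
qed

definition L_ser :: ser where "L_ser = theta G_ser * G_inv"

lemma L_commute: "coeff_commute L_ser L_ser" "coeff_commute L_ser G_inv" "coeff_commute (theta G_ser) G_ser"
proof -
  have GG: "coeff_commute G_ser G_ser"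
    by (simp add: coeff_commute_def G_ser_def altg_commute)
  have thG: "coeff_commute F (theta G_ser)" if "coeff_commute F G_ser" for F
    using that by (rule coeff_commute_termwise) simp
  have LF: "coeff_commute F L_ser" if "coeff_commute F G_ser" for F
    unfolding L_ser_def using that by (intro coeff_commute_mult thG coeff_commute_G_inv)
  have LG: "coeff_commute L_ser G_ser"
    using LF[OF GG] by (rule coeff_commute_sym)
  show "coeff_commute L_ser L_ser" using LG by (rule LF)
  show "coeff_commute L_ser G_inv" using LG by (rule coeff_commute_G_inv)
  show "coeff_commute (theta G_ser) G_ser" using thG[OF GG] by (rule coeff_commute_sym)
qed

lemmas G_ser_der [simp] = G_der[where a = 1, simplified]
  and W_ser_der [simp] = W_der[where a = 1, simplified]
  and G_inv_der_one [simp] = G_inv_der[where a = 1, simplified]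
  and cser_G_inv_one [simp] = cser_G_inv[where a = 1, simplified]

lemma cser_theta_G [simp]: "cser (theta G_ser) = 0" and cser_theta_W [simp]: "cser (theta W_ser) = 0"
  by (simp_all add: fps_eq_iff G_ser_def W_ser_def)

lemma theta_W_W: "theta W_ser * W_ser = W_ser * theta W_ser"
  by (rule commute_series) (simp add: W_ser_def altw_commute)

lemma theta_linear [simp]:
  "theta (F + F') = theta F + theta F'" "theta (c \<odot> F) = c \<odot> theta F" "theta 0 = 0" "theta 1 = 0"
  by (simp_all add: fps_eq_iff scal_add_right mult.commute)

text \<open>The infinitesimal form of the quadratic relations: what remains of them when the two scales
coincide to first order.\<close>

lemma theta_G_W: "(1 + qvar\<^sup>2) \<odot> (theta G_ser * W_ser - G_ser * theta W_ser) = G_ser * W_ser - W_ser * G_ser"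
  by (rule ser_eqI; simp add: dser_mult tser_mult dser_theta tser_theta theta_shift braid_letter
      coeff_commuteD[OF L_commute(3)] theta_W_W distrib_left distrib_right;
      simp add: ser_eq_iff field_simps power2_eq_square qvar_nonzero)

text \<open>The infinitesimal relation, multiplied by the inverse of \<open>G\<close> on both sides, removes the terms
containing \<open>theta\<close>.\<close>

lemma L_der:
  "cser L_ser = 0" "dser X L_ser = 0"
  "(qvar + inverse qvar) \<odot> dser Y L_ser = shift (inverse qvar \<odot> (G_inv * W_ser) + qvar \<odot> (W_ser * G_inv))"
proof -
  show "cser L_ser = 0" "dser X L_ser = 0"
    by (simp_all add: L_ser_def dser_mult dser_theta)
  have GH: "G_ser * G_inv = 1" "G_inv * G_ser = 1" using G_inv_inverse[of 1] by simp_all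
  have thG: "theta G_ser * G_inv = G_inv * theta G_ser"
    using coeff_commuteD[OF coeff_commute_G_inv[OF L_commute(3)]] .
  have "(1 + qvar\<^sup>2) \<odot> (G_inv * theta G_ser * W_ser * G_inv - G_inv * G_ser * theta W_ser * G_inv)
    = G_inv * ((1 + qvar\<^sup>2) \<odot> (theta G_ser * W_ser - G_ser * theta W_ser)) * G_inv"
    by (simp add: right_diff_distrib left_diff_distrib mult.assoc)
  also have "\<dots> = G_inv * (G_ser * W_ser - W_ser * G_ser) * G_inv"
    by (simp only: theta_G_W)
  also have "\<dots> = (G_inv * G_ser) * W_ser * G_inv - G_inv * W_ser * (G_ser * G_inv)"
    by (simp only: right_diff_distrib left_diff_distrib mult.assoc)
  finally have *: "(1 + qvar\<^sup>2) \<odot> (theta G_ser * G_inv * W_ser * G_inv - theta W_ser * G_inv) = W_ser * G_inv - G_inv * W_ser"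
    by (simp add: GH thG)
  have "dser Y L_ser = shift (W_ser * G_inv + theta W_ser * G_inv - theta G_ser * G_inv * W_ser * G_inv)"
    by (simp add: L_ser_def dser_mult dser_theta theta_shift distrib_right mult.assoc smul_distrib)
  moreover have "(qvar + inverse qvar) \<odot> (W_ser * G_inv + theta W_ser * G_inv - theta G_ser * G_inv * W_ser * G_inv)
    = inverse qvar \<odot> (G_inv * W_ser) + qvar \<odot> (W_ser * G_inv)"
  proof -
    have "inverse qvar \<odot> ((1 + qvar\<^sup>2) \<odot> (theta G_ser * G_inv * W_ser * G_inv - theta W_ser * G_inv)) = inverse qvar \<odot> (W_ser * G_inv - G_inv * W_ser)"
      by (simp only: *)
    then show ?thesis
      by (simp add: ser_eq_iff; simp add: field_simps power2_eq_square qvar_nonzero)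
  qed
  ultimately show "(qvar + inverse qvar) \<odot> dser Y L_ser = shift (inverse qvar \<odot> (G_inv * W_ser) + qvar \<odot> (W_ser * G_inv))"
    by (metis shift_smul)
qed

lemma qint_nat: "(qvar + inverse qvar) * qint (int n) = inverse qvar ^ n - (-1) ^ n * qvar ^ n"
  using qvar_sum_nonzero by (simp add: qint_def power_int_minus power_inverse)

text \<open>This says \<open>n (xy)\<^sup>n = \<Sum>\<^sub>i {i} x C\<^sub>i\<^sub>-\<^sub>1 y \<star> (xy)\<^sup>n\<^sup>-\<^sup>i\<close>. The two products \<open>G\<^sup>-\<^sup>1 W\<close> and \<open>W G\<^sup>-\<^sup>1\<close> are
rescalings of the same series of elements \<open>x C\<^sub>n\<close>, by \<open>1/\<alpha>\<close> and by \<open>1/\<beta>\<close>; the sum of the two powers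
is \<open>{n + 1}\<close> up to the common factor.\<close>

lemma L_nth: "fps_nth L_ser (Suc n) = qint (int (Suc n)) *\<^sub>s snoc (cons X (fps_nth K_ser n)) Y"
proof (rule qshuf_eqI)
  have "cf (fps_nth L_ser m) [] = 0" for m
    using arg_cong[OF L_der(1), of "\<lambda>A. fps_nth A m"] by simp
  then show "cf (fps_nth L_ser (Suc n)) [] = cf (qint (int (Suc n)) *\<^sub>s snoc (cons X (fps_nth K_ser n)) Y) []"
    by (simp add: cf_snoc_Nil)
  have X: "rder X (fps_nth L_ser (Suc n)) = 0"
    using arg_cong[OF L_der(2), of "\<lambda>A. fps_nth A (Suc n)"] by simp
  let ?X = "cons X (fps_nth K_ser n)"
  have "?X = \<alpha> ^ n *\<^sub>s fps_nth (G_inv * W_ser) n"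
    using arg_cong[OF consx_K, of "\<lambda>A. fps_nth A n"] by (simp flip: resc_mult)
  then have HW: "fps_nth (G_inv * W_ser) n = inverse qvar ^ n *\<^sub>s ?X"
    by (simp add: qvar_nonzero power_inverse)
  have "?X = \<beta> ^ n *\<^sub>s fps_nth (W_ser * G_inv) n"
    using arg_cong[OF consx_K, of "\<lambda>A. fps_nth A n"] unfolding G_inv_W_swap by (simp flip: resc_mult)
  then have WH: "fps_nth (W_ser * G_inv) n = (- qvar) ^ n *\<^sub>s ?X"
    by (simp add: qvar_nonzero flip: power_mult_distrib)
  have "(qvar + inverse qvar) *\<^sub>s rder Y (fps_nth L_ser (Suc n))
      = inverse qvar *\<^sub>s fps_nth (G_inv * W_ser) n + qvar *\<^sub>s fps_nth (W_ser * G_inv) n"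
    using arg_cong[OF L_der(3), of "\<lambda>A. fps_nth A (Suc n)"] by simp
  also have "\<dots> = (inverse qvar ^ Suc n - (-1) ^ Suc n * qvar ^ Suc n) *\<^sub>s ?X"
    unfolding HW WH by (simp add: power_minus[of qvar] algebra_simps flip: scal_add_left)
  also have "\<dots> = (qvar + inverse qvar) *\<^sub>s (qint (int (Suc n)) *\<^sub>s ?X)"
    unfolding qint_nat[symmetric] by simp
  finally have Y: "rder Y (fps_nth L_ser (Suc n)) = qint (int (Suc n)) *\<^sub>s ?X"
    using qvar_sum_nonzero by (metis left_inverse scal_simps(2,4))
  show "rder b (fps_nth L_ser (Suc n)) = rder b (qint (int (Suc n)) *\<^sub>s snoc ?X Y)" for b
    using X Y by (cases b) (simp_all add: rder_snoc)
qed

lemma L_nth_0: "fps_nth L_ser 0 = 0"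
  by (simp add: L_ser_def)

text \<open>The logarithmic derivative of a product of inverses is minus the sum of the logarithmic derivatives.\<close>

lemma theta_K: "theta K_ser = - (resc \<alpha> L_ser + resc \<beta> L_ser) * K_ser"
proof -
  have "G_ser * theta G_inv = - (theta G_ser * G_inv)"
    using arg_cong[OF G_inv_inverse(1)[of 1], of theta] by (simp add: theta_mult add_eq_0_iff2)
  then have "G_inv * (G_ser * theta G_inv) = - (G_inv * (theta G_ser * G_inv))" by simp
  then have "theta G_inv = - (G_inv * L_ser)"
    using G_inv_inverse(2)[of 1] by (simp add: L_ser_def flip: mult.assoc)
  then have thH: "theta (resc a G_inv) = - (resc a L_ser * resc a G_inv)" for a
    using coeff_commuteD[OF L_commute(2)]
    by (simp add: theta_resc resc_mult[symmetric] fps_eq_iff scal_minus_right)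
  have "coeff_commute (resc \<beta> L_ser) (resc \<alpha> G_inv)"
    using L_commute(2) by (simp add: coeff_commute_def mult.commute)
  then have "resc \<beta> L_ser * resc \<alpha> G_inv = resc \<alpha> G_inv * resc \<beta> L_ser"
    by (rule coeff_commuteD)
  then show ?thesis
    unfolding K_ser_def theta_mult thH by (simp add: left_diff_distrib flip: mult.assoc)
qed

section \<open>The exponential of a power series\<close>

definition exp_ser :: "ser \<Rightarrow> ser"
  where "exp_ser F = Abs_fps (\<lambda>n. \<Sum>m\<le>n. inverse (fact m) *\<^sub>s fps_nth (F ^ m) n)"

lemma theta_power:
  assumes "F * theta F = theta F * F"
  shows "theta (F ^ Suc m) = of_nat (Suc m) \<odot> (theta F * F ^ m)"
proof (induction m)
  case (Suc m)
  have c: "F * (theta F * A) = theta F * (F * A)" for A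
    using assms by (metis mult.assoc)
  have "theta (F ^ Suc (Suc m)) = theta F * F ^ Suc m + F * theta (F ^ Suc m)"
    by (subst power_Suc) (rule theta_mult)
  also have "\<dots> = of_nat (Suc (Suc m)) \<odot> (theta F * F ^ Suc m)"
    unfolding Suc by (simp add: c distrib_left) (simp add: ser_eq_iff algebra_simps)
  finally show ?case .
qed simp

lemma power_nth_eq_0:
  fixes F :: ser
  assumes "fps_nth F 0 = 0" "n < m"
  shows "fps_nth (F ^ m) n = 0"
  using assms(2)
proof (induction m arbitrary: n)
  case (Suc m)
  have "fps_nth F i * fps_nth (F ^ m) (n - i) = 0" if "i \<le> n" for i
    using Suc that by (cases "i = 0") (auto simp: assms(1))
  then show ?case by (simp add: fps_mult_nth)
qed simp

lemma exp_ser_nth: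
  assumes "fps_nth F 0 = 0" "n \<le> N"
  shows "fps_nth (exp_ser F) n = (\<Sum>m\<le>N. inverse (fact m) *\<^sub>s fps_nth (F ^ m) n)"
  unfolding exp_ser_def fps_nth_Abs_fps
  by (rule sum.mono_neutral_left) (use assms in \<open>auto simp: power_nth_eq_0\<close>)

lemma theta_exp:
  assumes "F * theta F = theta F * F" "fps_nth F 0 = 0"
  shows "theta (exp_ser F) = theta F * exp_ser F"
proof (rule fps_ext)
  fix n
  have "fps_nth (theta (exp_ser F)) n = (\<Sum>m\<le>Suc n. inverse (fact m) *\<^sub>s fps_nth (theta (F ^ m)) n)"
    using exp_ser_nth[OF assms(2), of n "Suc n"] by (simp add: scal_sum scal_add_right mult.commute)
  also have "\<dots> = (\<Sum>m\<le>n. inverse (fact (Suc m)) *\<^sub>s fps_nth (theta (F ^ Suc m)) n)"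
    by (subst sum.atMost_Suc_shift) simp
  also have "\<dots> = (\<Sum>m\<le>n. inverse (fact m) *\<^sub>s fps_nth (theta F * F ^ m) n)"
  proof (rule sum.cong)
    fix m
    have "inverse (fact (Suc m)) * of_nat (Suc m) = (inverse (fact m) :: ratfun)"
      unfolding fact_Suc by (simp add: field_simps del: of_nat_Suc)
    then show "inverse (fact (Suc m)) *\<^sub>s fps_nth (theta (F ^ Suc m)) n
        = inverse (fact m) *\<^sub>s fps_nth (theta F * F ^ m) n"
      unfolding theta_power[OF assms(1)] by (simp only: ser_nth scal_simps)
  qed simp
  also have "\<dots> = (\<Sum>i=0..n. \<Sum>m\<le>n. inverse (fact m) *\<^sub>s (fps_nth (theta F) i * fps_nth (F ^ m) (n - i)))"
    unfolding fps_mult_nth scal_sum by (rule sum.swap)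
  also have "\<dots> = fps_nth (theta F * exp_ser F) n"
    unfolding fps_mult_nth
    by (rule sum.cong) (simp_all add: exp_ser_nth[OF assms(2), of _ n] sum_distrib_left)
  finally show "fps_nth (theta (exp_ser F)) n = fps_nth (theta F * exp_ser F) n" .
qed

text \<open>The equation determines the coefficient of \<open>t\<^sup>n\<close> from lower ones after division by \<open>n\<close>.\<close>

lemma theta_eq_unique:
  assumes "theta E = D * E" "theta E' = D * E'" "fps_nth D 0 = 0" "fps_nth E 0 = fps_nth E' 0"
  shows "E = E'"
proof (rule fps_ext)
  fix n
  show "fps_nth E n = fps_nth E' n"
  proof (induction n rule: less_induct)
    case (less n)
    show ?case
    proof (cases "n = 0")
      case False
      have "fps_nth D i * fps_nth E (n - i) = fps_nth D i * fps_nth E' (n - i)" if "i \<in> {0..n}" for i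
        using less[of "n - i"] False by (cases "i = 0") (simp_all add: assms(3))
      then have "fps_nth (D * E) n = fps_nth (D * E') n"
        unfolding fps_mult_nth by (rule sum.cong[OF refl])
      then have "of_nat n *\<^sub>s fps_nth E n = of_nat n *\<^sub>s fps_nth E' n"
        by (simp flip: assms(1,2))
      moreover have "(of_nat n :: ratfun) \<noteq> 0" using False by simp
      ultimately show ?thesis by (metis left_inverse scal_simps(2,4))
    qed (simp add: assms(4))
  qed
qed

section \<open>The Catalan elements\<close>

text \<open>Prefixes of every length are allowed here, also the empty one and those longer than the word.\<close>

lemma bar_prefix_nonneg:
  assumes "v \<in> Cat n"
  shows "sum_list (map bar (take k v)) \<ge> 0"
proof -
  consider "k = 0" | "k \<in> {1..length v}" | "k > length v" by fastforce
  then show ?thesis using assms by cases (auto simp: Cat_def)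
qed

lemma insert_in_Cat:
  assumes v: "v \<in> Cat n" and i: "i \<le> length v"
  shows "take i v @ [X] @ drop i v @ [Y] \<in> Cat (Suc n)"
proof -
  have total: "sum_list (map bar (take i v)) + sum_list (map bar (drop i v)) = 0"
    using v by (simp add: Cat_def flip: sum_list_append map_append)
  have "sum_list (map bar (take j (take i v @ [X] @ drop i v @ [Y]))) \<ge> 0" for j
  proof (cases "j \<le> i")
    case True
    then show ?thesis using bar_prefix_nonneg[OF v, of j] i by (simp add: min_absorb1)
  next
    case False
    then obtain k where j: "j = i + Suc k"
      by (metis add_Suc_right less_iff_Suc_add not_le)
    have split: "sum_list (map bar (take (i + k) v))
      = sum_list (map bar (take i v)) + sum_list (map bar (take k (drop i v)))"
      by (simp add: take_add)
    show ?thesis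
    proof (cases "k \<le> length v - i")
      case True
      then show ?thesis
        using i split bar_prefix_nonneg[OF v, of "i + k"] by (simp add: j min_absorb1)
    next
      case False
      then show ?thesis using i total by (simp add: j take_Cons' )
    qed
  qed
  then show ?thesis using v i total by (simp add: Cat_def)
qed

lemma braid_X: "braid u X = (-1) ^ length u * qvar powi (2 * sum_list (map bar u))"
proof -
  have "pairing c X = 2 * bar c" for c by (cases c) simp_all
  then show ?thesis by (simp add: braid_def sum_list_const_mult)
qed

text \<open>A single letter \<open>x\<close> is inserted at every position, with the scalar of the part that it passes. The
scalar for passing from the left is the same as from the right since the pairing is symmetric.\<close>

lemma shuffle_X_left:
  "word [X] \<star> word v = (\<Sum>i\<le>length v. braid (take i v) X *\<^sub>f word (take i v @ [X] @ drop i v))"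
proof (induction v)
  case (Cons b v)
  have "braid [X] b = braid [b] X" by (simp add: braid_singleton)
  then have "word [X] \<star> word (b # v) = word (X # b # v) + braid [b] X *\<^sub>f (word [b] * (word [X] \<star> word v))"
    by (simp add: shuffle_word_Cons word_mult)
  also have "braid [b] X *\<^sub>f (word [b] * (word [X] \<star> word v))
    = (\<Sum>i\<le>length v. braid (b # take i v) X *\<^sub>f word (b # take i v @ [X] @ drop i v))"
    unfolding Cons sum_distrib_left scale_sum
    by (rule sum.cong) (simp_all add: scale_mult_right word_mult scale_scale flip: braid_Cons)
  finally show ?case
    by (simp add: sum.atMost_Suc_shift del: shuffle_word_word sum.atMost_Suc)
qed (simp add: word_Nil)

lemma shuffle_X_right:
  "word v \<star> word [X] = (\<Sum>i\<le>length v. braid (drop i v) X *\<^sub>f word (take i v @ [X] @ drop i v))"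
proof (induction v)
  case (Cons a v)
  have "word (a # v) \<star> word [X] = braid (a # v) X *\<^sub>f word (X # a # v) + word [a] * (word v \<star> word [X])"
    by (simp add: shuffle_word_Cons word_mult)
  also have "word [a] * (word v \<star> word [X])
    = (\<Sum>i\<le>length v. braid (drop i v) X *\<^sub>f word (a # take i v @ [X] @ drop i v))"
    unfolding Cons sum_distrib_left
    by (rule sum.cong) (simp_all add: scale_mult_right word_mult)
  finally show ?case
    by (simp add: sum.atMost_Suc_shift del: shuffle_word_word sum.atMost_Suc)
qed (simp add: word_Nil)

text \<open>In a balanced word the part after position \<open>i\<close> has the negative of the height at \<open>i\<close>, so the two
scalars are inverse powers of \<open>q\<close> with the same sign and their difference is a \<open>q\<close>-integer.\<close>

lemma Cs_weight:
  assumes v: "v \<in> Cat n" and "i \<le> length v"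
  shows "(qvar + inverse qvar) * ((-1) ^ i * qint (2 + 2 * sum_list (map bar (take i v))))
    = (inverse qvar)\<^sup>2 * braid (drop i v) X - qvar\<^sup>2 * braid (take i v) X"
proof -
  define h where "h = sum_list (map bar (take i v))"
  have d: "sum_list (map bar (drop i v)) = - h"
  proof -
    have "h + sum_list (map bar (drop i v)) = 0"
      using v by (simp add: h_def Cat_def flip: sum_list_append map_append)
    then show ?thesis by simp
  qed
  have "even (length (drop i v)) = even i"
    using v assms(2) by (auto simp: Cat_def)
  then have "(-1) ^ length (drop i v) = ((-1) ^ i :: ratfun)"
    by (simp add: minus_one_power_iff)
  then have 1: "braid (drop i v) X = (-1) ^ i * qvar powi (- (2 * h))"
    unfolding braid_X d by simp
  have 2: "braid (take i v) X = (-1) ^ i * qvar powi (2 * h)"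
    unfolding braid_X h_def using assms(2) by (simp add: min_absorb2)
  have e: "(-1) powi (2 + 2 * h) = (1 :: ratfun)"
    by (simp add: power_int_minus_left)
  have "(qvar + inverse qvar) * qint (2 + 2 * h) = qvar powi (- (2 + 2 * h)) - qvar powi (2 + 2 * h)"
    using qvar_sum_nonzero by (simp add: qint_def e)
  also have "qvar powi (- (2 + 2 * h)) = (inverse qvar)\<^sup>2 * qvar powi (- (2 * h))"
    using power_int_add[of qvar "-2" "- (2 * h)"] qvar_nonzero
    by (simp add: power_int_minus power_inverse)
  also have "qvar powi (2 + 2 * h) = qvar\<^sup>2 * qvar powi (2 * h)"
    using qvar_nonzero by (simp add: power_int_add)
  finally have F: "(qvar + inverse qvar) * qint (2 + 2 * h)
      = (inverse qvar)\<^sup>2 * qvar powi (- (2 * h)) - qvar\<^sup>2 * qvar powi (2 * h)" .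
  show ?thesis
    unfolding 1 2 h_def[symmetric] mult.left_commute[of "qvar + inverse qvar"] F
    by (simp add: right_diff_distrib mult.left_commute)
qed

lemma Cs_elem_0: "Cs_elem 0 = 1"
proof -
  have "Cat 0 = {[]}" by (auto simp: Cat_def)
  then show ?thesis by (simp add: Cs_elem_def word_Nil)
qed

lemma scale_sum_left: "(\<Sum>i\<in>I. f i) *\<^sub>f p = (\<Sum>i\<in>I. f i *\<^sub>f (p :: 'l free_alg))"
  by (induction I rule: infinite_finite_induct) (simp_all add: scale_add_left)

lemma scale_diff_left: "(a - b) *\<^sub>f p = a *\<^sub>f p - b *\<^sub>f (p :: 'l free_alg)"
  by (rule poly_mapping_eqI) (simp add: lookup_minus left_diff_distrib)

lemma shuffle_sum:
  "(\<Sum>i\<in>I. f i) \<star> p = (\<Sum>i\<in>I. f i \<star> p)" "p \<star> (\<Sum>i\<in>I. f i) = (\<Sum>i\<in>I. p \<star> f i)"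
  by (induction I rule: infinite_finite_induct; simp add: shuffle_add_left shuffle_add_right)+

text \<open>The recursion for the weights inserts an \<open>x\<close> and appends a \<open>y\<close>. Grouping the insertions by the
resulting word turns it into a recursion for the elements.\<close>

lemma Cs_elem_Suc:
  "(qvar + inverse qvar) *\<^sub>f Cs_elem (Suc n)
    = ((inverse qvar)\<^sup>2 *\<^sub>f (Cs_elem n \<star> word [X]) - qvar\<^sup>2 *\<^sub>f (word [X] \<star> Cs_elem n)) * word [Y]"
proof -
  define c where "c v i = (-1) ^ i * qint (2 + 2 * sum_list (map bar (take i v)))" for v i
  define e where "e v i = take i v @ [X] @ drop i v @ [Y]" for v and i :: nat
  let ?k = "qvar + inverse qvar"
  have inner: "(\<Sum>w\<in>Cat (Suc n). (\<Sum>i \<in> {i \<in> {0..length v}. w = e v i}. c v i) *\<^sub>f word w)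
      = (\<Sum>i\<le>length v. c v i *\<^sub>f word (e v i))" if "v \<in> Cat n" for v
  proof -
    have "(\<Sum>w\<in>Cat (Suc n). (\<Sum>i \<in> {i \<in> {0..length v}. w = e v i}. c v i) *\<^sub>f word w)
      = (\<Sum>w\<in>Cat (Suc n). \<Sum>i \<in> {i \<in> {..length v}. e v i = w}. c v i *\<^sub>f word (e v i))"
      unfolding scale_sum_left by (intro sum.cong) auto
    also have "\<dots> = (\<Sum>i\<le>length v. c v i *\<^sub>f word (e v i))"
      by (rule sum.group) (use insert_in_Cat[OF that] in \<open>auto simp: finite_Cat e_def\<close>)
    finally show ?thesis .
  qed
  have Cs: "Cs (Suc n) w = (\<Sum>v\<in>Cat n. Cs n v * (\<Sum>i \<in> {i \<in> {0..length v}. w = e v i}. c v i))" for w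
    by (simp add: c_def e_def)
  have "Cs_elem (Suc n) = (\<Sum>w\<in>Cat (Suc n). \<Sum>v\<in>Cat n.
      Cs n v *\<^sub>f (\<Sum>i \<in> {i \<in> {0..length v}. w = e v i}. c v i) *\<^sub>f word w)"
    unfolding Cs_elem_def Cs scale_scale by (simp only: scale_sum_left)
  also have "\<dots> = (\<Sum>v\<in>Cat n. \<Sum>w\<in>Cat (Suc n).
      Cs n v *\<^sub>f (\<Sum>i \<in> {i \<in> {0..length v}. w = e v i}. c v i) *\<^sub>f word w)"
    by (rule sum.swap)
  also have "\<dots> = (\<Sum>v\<in>Cat n. Cs n v *\<^sub>f (\<Sum>i\<le>length v. c v i *\<^sub>f word (e v i)))"
    by (rule sum.cong[OF refl]) (simp only: inner flip: scale_sum)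
  finally have "?k *\<^sub>f Cs_elem (Suc n)
      = (\<Sum>v\<in>Cat n. Cs n v *\<^sub>f ?k *\<^sub>f (\<Sum>i\<le>length v. c v i *\<^sub>f word (e v i)))"
    by (simp only: scale_sum scale_scale mult.commute mult.left_commute)
  also have "\<dots> = (\<Sum>v\<in>Cat n. Cs n v *\<^sub>f
      (((inverse qvar)\<^sup>2 *\<^sub>f (word v \<star> word [X]) - qvar\<^sup>2 *\<^sub>f (word [X] \<star> word v)) * word [Y]))"
  proof (rule sum.cong[OF refl])
    fix v assume v: "v \<in> Cat n"
    have "?k *\<^sub>f (\<Sum>i\<le>length v. c v i *\<^sub>f word (e v i))
      = (\<Sum>i\<le>length v. ((inverse qvar)\<^sup>2 * braid (drop i v) X - qvar\<^sup>2 * braid (take i v) X) *\<^sub>f word (e v i))"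
      unfolding scale_sum scale_scale c_def by (rule sum.cong[OF refl]) (simp only: Cs_weight[OF v] atMost_iff)
    also have "\<dots> = ((inverse qvar)\<^sup>2 *\<^sub>f (word v \<star> word [X]) - qvar\<^sup>2 *\<^sub>f (word [X] \<star> word v)) * word [Y]"
      unfolding shuffle_X_left shuffle_X_right scale_sum left_diff_distrib sum_distrib_right
        scale_mult_left word_mult e_def scale_diff_left sum_subtractf scale_scale append_assoc ..
    finally show "Cs n v *\<^sub>f ?k *\<^sub>f (\<Sum>i\<le>length v. c v i *\<^sub>f word (e v i)) = Cs n v *\<^sub>f
      (((inverse qvar)\<^sup>2 *\<^sub>f (word v \<star> word [X]) - qvar\<^sup>2 *\<^sub>f (word [X] \<star> word v)) * word [Y])"
      by (rule arg_cong)
  qed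
  also have "\<dots> = ((inverse qvar)\<^sup>2 *\<^sub>f (Cs_elem n \<star> word [X]) - qvar\<^sup>2 *\<^sub>f (word [X] \<star> Cs_elem n)) * word [Y]"
    unfolding Cs_elem_def shuffle_sum shuffle_scale_left shuffle_scale_right scale_sum left_diff_distrib
      sum_distrib_right scale_mult_left scale_diff_right scale_scale sum_subtractf
    by (simp only: mult.commute)
  finally show ?thesis .
qed

lift_definition cat :: "nat \<Rightarrow> qshuf" is Cs_elem .

lemma cat_0: "cat 0 = 1"
  by transfer (rule Cs_elem_0)

lemma cat_Suc:
  "(qvar + inverse qvar) *\<^sub>s cat (Suc n)
    = snoc ((inverse qvar)\<^sup>2 *\<^sub>s (cat n * qword [X]) - qvar\<^sup>2 *\<^sub>s (qword [X] * cat n)) Y"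
  by transfer (rule Cs_elem_Suc)

lemma rder_Y_K:
  "(qvar + inverse qvar) *\<^sub>s rder Y (fps_nth K_ser (Suc n))
    = (inverse qvar)\<^sup>2 *\<^sub>s (fps_nth K_ser n * qword [X]) - qvar\<^sup>2 *\<^sub>s (qword [X] * fps_nth K_ser n)"
  using arg_cong[OF K_der(4), of "\<lambda>A. fps_nth A (Suc n)"] by (simp add: x_ser_def)

lemma K_nth_simps:
  "rder X (fps_nth K_ser n) = 0" "twist b (fps_nth K_ser n) = fps_nth K_ser n" "cf (fps_nth K_ser n) [] = (if n = 0 then 1 else 0)"
  using arg_cong[OF K_der(1), of "\<lambda>A. fps_nth A n"] arg_cong[OF K_der(2), of "\<lambda>A. fps_nth A n"]
    arg_cong[OF K_der(3), of "\<lambda>A. fps_nth A n"] by simp_all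

lemma qsum_cancel: "(qvar + inverse qvar) *\<^sub>s p = (qvar + inverse qvar) *\<^sub>s r \<Longrightarrow> p = r"
  using qvar_sum_nonzero by (metis left_inverse scal_simps(2,4))

lemma K_nth_0: "fps_nth K_ser 0 = 1"
proof -
  have h0: "fps_nth G_inv 0 = 1" using arg_cong[OF G_inv_G, of "\<lambda>A. fps_nth A 0"] by (simp add: G_ser_def)
  then show ?thesis by (simp add: K_ser_def)
qed

text \<open>Both sides obey the same recursion for the last letter.\<close>

lemma K_nth: "fps_nth K_ser n = cat n"
proof (induction n)
  case 0
  show ?case by (simp add: K_nth_0 cat_0)
next
  case (Suc n)
  have "(qvar + inverse qvar) *\<^sub>s fps_nth K_ser (Suc n) = (qvar + inverse qvar) *\<^sub>s cat (Suc n)"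
  proof (rule qshuf_eqI)
    show "cf ((qvar + inverse qvar) *\<^sub>s fps_nth K_ser (Suc n)) [] = cf ((qvar + inverse qvar) *\<^sub>s cat (Suc n)) []"
      unfolding cat_Suc by (simp add: K_nth_simps cf_snoc_Nil)
    fix b
    show "rder b ((qvar + inverse qvar) *\<^sub>s fps_nth K_ser (Suc n)) = rder b ((qvar + inverse qvar) *\<^sub>s cat (Suc n))"
      unfolding cat_Suc using rder_Y_K[of n] by (cases b) (simp_all add: K_nth_simps rder_snoc Suc)
  qed
  then show ?case by (rule qsum_cancel)
qed

section \<open>The images of the root vectors\<close>

definition Phi :: "uq \<Rightarrow> qshuf" where "Phi a = Abs_qshuf (phi a)"

lemma Rep_Phi: "Rep_qshuf (Phi a) = phi a"
  by (simp add: Phi_def Abs_qshuf_inverse)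

lemma Phi_simps [simp]:
  "Phi (a + b) = Phi a + Phi b" "Phi (c *\<^sub>u a) = c *\<^sub>s Phi a" "Phi 1 = 1" "Phi (a * b) = Phi a * Phi b"
  "Phi uA = qword [X]" "Phi uB = qword [Y]"
  unfolding Rep_qshuf_inject[symmetric] Rep_Phi plus_qshuf.rep_eq scal.rep_eq one_qshuf.rep_eq
    times_qshuf.rep_eq qword.rep_eq
  by (rule phi_add phi_scale phi_one phi_mult phi_uA phi_uB)+

lemma Phi_diff [simp]: "Phi (a - b) = Phi a - Phi b"
  using Phi_simps(1)[of "a - b" b] by simp

lemma Phi_zero [simp]: "Phi 0 = 0"
  using Phi_diff[of 0 0] by simp

lemma Phi_sum: "Phi (\<Sum>i\<in>I. f i) = (\<Sum>i\<in>I. Phi (f i))"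
  by (induction I rule: infinite_finite_induct) simp_all

lemma letter_simps [simp]:
  "rder b (qword [a]) = (if a = b then 1 else 0)" "twist b (qword [a]) = braid [a] b *\<^sub>s qword [a]"
  "cf (qword [a]) [] = 0"
  by (simp_all add: rder_qword twist_qword qword_Nil cf_qword)

lemma qvar_inverse_powi: "qvar powi (-2) = (inverse qvar)\<^sup>2"
  by (simp add: power_int_minus power_inverse)

lemma Phi_E_delta: "Phi E_delta = (1 - inverse qvar ^ 4) *\<^sub>s altg 1"
proof (rule qshuf_eqI)
  fix b
  have "rder Y (altg 1) = qword [X]" by (simp add: altw_0 del: altg.simps)
  then show "rder b (Phi E_delta) = rder b ((1 - inverse qvar ^ 4) *\<^sub>s altg 1)"
    by (cases b)
      (simp_all add: E_delta_def qvar_inverse_powi rder_mult braid_letter scal_diff_left scal_minus_left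
        scal_minus_right power4_eq_xxxx power2_eq_square mult.assoc del: altg.simps One_nat_def)
qed (simp add: E_delta_def cf_Nil_mult del: altg.simps)

text \<open>The left-hand side is, up to a scalar, the expression that defines the root vector of \<open>(n + 1)\<delta>\<close>. Its
two terms have opposite \<open>x\<close>-derivatives, and its \<open>y\<close>-derivative is that of \<open>C\<^sub>n\<^sub>+\<^sub>1\<close> up to a scalar.\<close>

lemma E_delta_recursion:
  "qword [X] * snoc (fps_nth K_ser n) Y + (inverse qvar)\<^sup>2 *\<^sub>s (snoc (fps_nth K_ser n) Y * qword [X])
    = - (((inverse qvar)\<^sup>2 * (qvar + inverse qvar)) *\<^sub>s fps_nth K_ser (Suc n))"
proof (rule qshuf_eqI)
  fix b
  have K_ser: "((inverse qvar)\<^sup>2 * (qvar + inverse qvar)) *\<^sub>s rder Y (fps_nth K_ser (Suc n))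
      = (inverse qvar)\<^sup>2 *\<^sub>s ((inverse qvar)\<^sup>2 *\<^sub>s (fps_nth K_ser n * qword [X]) - qvar\<^sup>2 *\<^sub>s (qword [X] * fps_nth K_ser n))"
    unfolding rder_Y_K[symmetric] by simp
  show "rder b (qword [X] * snoc (fps_nth K_ser n) Y + (inverse qvar)\<^sup>2 *\<^sub>s (snoc (fps_nth K_ser n) Y * qword [X]))
    = rder b (- (((inverse qvar)\<^sup>2 * (qvar + inverse qvar)) *\<^sub>s fps_nth K_ser (Suc n)))"
    by (cases b)
      (simp_all add: K_ser rder_mult rder_snoc twist_snoc braid_letter K_nth_simps scal_diff_right scal_minus_left
        scal_minus_right)
qed (simp add: cf_Nil_mult K_nth_simps)

lemma K_commute_altg: "fps_nth K_ser n * altg m = altg m * fps_nth K_ser n"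
proof -
  have "coeff_commute G_ser G_inv"
    by (rule coeff_commute_G_inv) (simp add: coeff_commute_def G_ser_def altg_commute)
  then have "coeff_commute G_ser (resc a G_inv)" for a
    by (rule coeff_commute_termwise) simp
  then have "coeff_commute G_ser K_ser"
    unfolding K_ser_def by (intro coeff_commute_mult)
  then show ?thesis by (simp add: coeff_commute_def G_ser_def)
qed

text \<open>Since \<open>xy\<close> commutes with \<open>C\<^sub>n\<close>, the derivative of the commutator contains only the terms in which the
\<open>y\<close> of \<open>xy\<close> is deleted, and these were computed in the preceding recursion.\<close>

lemma commutator_snoc_K:
  "altg 1 * snoc (fps_nth K_ser n) Y - snoc (fps_nth K_ser n) Y * altg 1
    = (qvar + inverse qvar) *\<^sub>s snoc (fps_nth K_ser (Suc n)) Y"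
proof (rule qshuf_eqI)
  fix b
  have Y1: "rder Y (altg 1) = qword [X]" by (simp add: altw_0 del: altg.simps)
  have T: "qvar\<^sup>2 *\<^sub>s (qword [X] * snoc (fps_nth K_ser n) Y) + snoc (fps_nth K_ser n) Y * qword [X]
      = - ((qvar + inverse qvar) *\<^sub>s fps_nth K_ser (Suc n))"
    using arg_cong[OF E_delta_recursion[of n], of "scal (qvar\<^sup>2)"]
    by (simp add: scal_add_right scal_minus_right flip: mult.assoc)
  have "qvar\<^sup>2 *\<^sub>s (qword [X] * snoc (fps_nth K_ser n) Y)
      = - ((qvar + inverse qvar) *\<^sub>s fps_nth K_ser (Suc n)) - snoc (fps_nth K_ser n) Y * qword [X]"
    unfolding T[symmetric] by simp
  then show "rder b (altg 1 * snoc (fps_nth K_ser n) Y - snoc (fps_nth K_ser n) Y * altg 1)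
    = rder b ((qvar + inverse qvar) *\<^sub>s snoc (fps_nth K_ser (Suc n)) Y)"
    by (cases b)
      (simp_all add: rder_mult rder_snoc twist_snoc braid_letter K_nth_simps Y1 K_commute_altg scal_minus_left
        del: altg.simps One_nat_def)
qed (simp add: cf_Nil_mult cf_snoc_Nil)

text \<open>The scale by which the recursions for the root vectors grow in each step.\<close>

definition omega :: ratfun where "omega = (inverse qvar)\<^sup>2 * (qvar + inverse qvar)\<^sup>2"

lemma qvar_diff_nonzero: "qvar - inverse qvar \<noteq> 0"
proof -
  have "qvar * qvar - 1 \<noteq> 0"
    by (simp add: qvar_def One_fract_def Zero_fract_def eq_fract one_pCons)
  moreover have "qvar * (qvar - inverse qvar) = qvar * qvar - 1"
    using qvar_nonzero by (simp add: right_diff_distrib)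
  ultimately show ?thesis by fastforce
qed

lemma Phi_E_alpha1: "Phi (E_alpha1 n) = omega ^ n *\<^sub>s snoc (fps_nth K_ser n) Y"
proof (induction n)
  case 0
  have "qword [Y] = snoc 1 Y" by transfer simp
  then show ?case by (simp add: K_nth_0)
next
  case (Suc n)
  have om: "omega = inverse (qvar - inverse qvar) * (1 - inverse qvar ^ 4) * (qvar + inverse qvar)"
  proof -
    have "(qvar - inverse qvar) * omega = (1 - inverse qvar ^ 4) * (qvar + inverse qvar)"
      unfolding omega_def by (simp add: field_simps qvar_nonzero power2_eq_square power4_eq_xxxx)
    then show ?thesis using qvar_diff_nonzero by (simp add: field_simps)
  qed
  have "Phi (E_alpha1 (Suc n)) = (inverse (qvar - inverse qvar) * (1 - inverse qvar ^ 4) * omega ^ n) *\<^sub>s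
      (altg 1 * snoc (fps_nth K_ser n) Y - snoc (fps_nth K_ser n) Y * altg 1)"
    by (simp add: Suc Phi_E_delta scal_diff_right mult_ac del: altg.simps One_nat_def)
  also have "\<dots> = omega ^ Suc n *\<^sub>s snoc (fps_nth K_ser (Suc n)) Y"
    unfolding commutator_snoc_K by (simp add: om mult_ac)
  finally show ?case .
qed

lemma Phi_E_ndelta:
  "(qvar + inverse qvar) *\<^sub>s Phi (E_ndelta (Suc n)) = - (omega ^ Suc n *\<^sub>s fps_nth K_ser (Suc n))"
proof -
  have "Phi (E_ndelta (Suc n)) = omega ^ n *\<^sub>s (qword [X] * snoc (fps_nth K_ser n) Y
      + (inverse qvar)\<^sup>2 *\<^sub>s (snoc (fps_nth K_ser n) Y * qword [X]))"
    by (simp add: E_ndelta_def Phi_E_alpha1 qvar_inverse_powi scal_add_right mult.commute add.commute)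
  then show ?thesis
    unfolding E_delta_recursion by (simp add: scal_minus_right omega_def power2_eq_square mult_ac)
qed

definition Phi_ser :: "uq fps \<Rightarrow> ser" where "Phi_ser F = Abs_fps (\<lambda>n. Phi (fps_nth F n))"

lemma Phi_ser_power: "Phi_ser (F ^ m) = Phi_ser F ^ m"
proof (induction m)
  case (Suc m)
  have "Phi_ser (F * F ^ m) = Phi_ser F * Phi_ser (F ^ m)"
    by (simp add: Phi_ser_def fps_eq_iff fps_mult_nth Phi_sum)
  then show ?case by (simp add: Suc)
qed (simp add: Phi_ser_def fps_eq_iff)

lemma Phi_exp: "Phi_ser (exp_series F) = exp_ser (Phi_ser F)"
  by (simp add: fps_eq_iff exp_ser_def exp_series_def Phi_sum flip: Phi_ser_power)
    (simp add: Phi_ser_def Phi_sum)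

text \<open>Term-by-term integration of the logarithmic derivative of \<open>K_ser\<close>. At \<open>n = 0\<close> the
division by zero gives zero, the right constant term.\<close>

definition log_K :: ser
  where "log_K = Abs_fps (\<lambda>n. (- (\<alpha> ^ n + \<beta> ^ n) / of_nat n) *\<^sub>s fps_nth L_ser n)"

lemma exp_log_K: "exp_ser log_K = K_ser"
proof -
  have 0: "fps_nth log_K 0 = 0" by (simp add: log_K_def)
  have th: "theta log_K = - (resc \<alpha> L_ser + resc \<beta> L_ser)"
  proof (rule fps_ext)
    fix n
    show "fps_nth (theta log_K) n = fps_nth (- (resc \<alpha> L_ser + resc \<beta> L_ser)) n"
      by (cases "n = 0")
        (simp_all add: log_K_def L_nth_0 scal_diff_left scal_minus_left)
  qed
  have "coeff_commute log_K L_ser"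
    by (rule coeff_commute_sym, rule coeff_commute_termwise[OF L_commute(1)])
      (simp add: log_K_def)
  then have "coeff_commute log_K log_K"
    by (rule coeff_commute_termwise) (simp add: log_K_def)
  then have "coeff_commute log_K (theta log_K)"
    by (rule coeff_commute_termwise) simp
  then have "theta (exp_ser log_K) = theta log_K * exp_ser log_K"
    using 0 by (intro theta_exp coeff_commuteD)
  then show ?thesis
    using theta_K unfolding th
    by (rule theta_eq_unique) (simp_all add: L_nth_0 K_nth_0 exp_ser_def)
qed

lemma exp_ser_resc: "exp_ser (resc a F) = resc a (exp_ser F)"
proof -
  have "resc a F ^ m = resc a (F ^ m)" for m
    by (induction m) (simp_all add: resc_mult)
  then show ?thesis
    by (simp add: fps_eq_iff exp_ser_def scal_sum mult.commute)
qed

text \<open>In degree \<open>n\<close> the exponential is the coefficient of the series itself plus terms that depend on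
lower coefficients only, because higher powers of a series without constant term do.\<close>

lemma exp_ser_inj:
  assumes "exp_ser F = exp_ser F'" "fps_nth F 0 = 0" "fps_nth F' 0 = 0"
  shows "F = F'"
proof (rule fps_ext)
  fix n
  show "fps_nth F n = fps_nth F' n"
  proof (induction n rule: less_induct)
    case (less n)
    show ?case
    proof (cases "n = 0")
      case False
      have low: "fps_nth (F ^ m) k = fps_nth (F' ^ m) k" if "k < n" for m k
        using that
      proof (induction m arbitrary: k)
        case (Suc m)
        then show ?case by (auto simp: fps_mult_nth less intro!: sum.cong)
      qed simp
      have pow: "fps_nth (F ^ Suc (Suc m)) n = fps_nth (F' ^ Suc (Suc m)) n" for m
      proof -
        have "fps_nth F i * fps_nth (F ^ Suc m) (n - i) = fps_nth F' i * fps_nth (F' ^ Suc m) (n - i)"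
          if i: "i \<in> {0..n}" for i
        proof -
          consider "i = 0" | "i = n" | "i < n" "n - i < n" using i False by fastforce
          then show ?thesis
          proof cases
            case 2
            then show ?thesis by (simp add: assms)
          qed (simp_all add: assms less low del: power_Suc)
        qed
        then show ?thesis
          by (subst (1 2) power_Suc) (simp add: fps_mult_nth del: power_Suc)
      qed
      obtain n' where n': "n = Suc n'" using False not0_implies_Suc by blast
      have split: "(\<Sum>m\<le>Suc n'. f m) = f 0 + (f 1 + (\<Sum>m<n'. f (Suc (Suc m))))" for f :: "nat \<Rightarrow> qshuf"
        by (simp only: lessThan_Suc_atMost[symmetric] sum.lessThan_Suc_shift One_nat_def)
      have e: "fps_nth (exp_ser A) n
        = fps_nth A n + (\<Sum>m<n'. inverse (fact (Suc (Suc m))) *\<^sub>s fps_nth (A ^ Suc (Suc m)) n)" for A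
        unfolding exp_ser_def n' fps_nth_Abs_fps split by simp
      show ?thesis
        using arg_cong[OF assms(1), of "\<lambda>A. fps_nth A n"] unfolding e pow
        by simp
    qed (simp add: assms)
  qed
qed

theorem theorem46:
  fixes n :: nat
  assumes "n \<ge> 1"
  shows "phi (E_Beck n)
    = ((-1) ^ n * (qint (2 * int n) / of_nat n) * qvar powi (- 2 * int n)
        * (qvar + inverse qvar) ^ (2 * n - 1))
      *\<^sub>f (word [X] * Cs_elem (n - 1) * word [Y])"
proof -
  let ?c = "qvar + inverse qvar"
  let ?B = "scale_series (- ?c) (gen_series E_Beck)"
  have "exp_ser (Phi_ser ?B) = Phi_ser (1 - scale_series ?c (gen_series E_ndelta))"
    using beck_identity_E_Beck by (simp add: beck_identity_def flip: Phi_exp)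
  also have "\<dots> = resc omega K_ser"
  proof (rule fps_ext)
    fix k
    show "fps_nth (Phi_ser (1 - scale_series ?c (gen_series E_ndelta))) k = fps_nth (resc omega K_ser) k"
      using Phi_E_ndelta
      by (cases k) (simp_all add: Phi_ser_def scale_series_def gen_series_def K_nth_0 scale_uq_zero)
  qed
  also have "\<dots> = exp_ser (resc omega log_K)"
    by (simp add: exp_ser_resc exp_log_K)
  finally have "Phi_ser ?B = resc omega log_K"
    by (rule exp_ser_inj) (simp_all add: Phi_ser_def scale_series_def gen_series_def scale_uq_zero log_K_def)
  from arg_cong[OF this, of "\<lambda>A. fps_nth A n"]
  have "(- ?c) *\<^sub>s Phi (E_Beck n) = (omega ^ n * (- (\<alpha> ^ n + \<beta> ^ n) / of_nat n)) *\<^sub>s fps_nth L_ser n"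
    using assms by (simp only: Phi_ser_def scale_series_def gen_series_def log_K_def
        fps_nth_Abs_fps ser_nth scal_simps Phi_simps) simp
  then have 1: "?c *\<^sub>s Phi (E_Beck n) = (omega ^ n * ((\<alpha> ^ n + \<beta> ^ n) / of_nat n)) *\<^sub>s fps_nth L_ser n"
    by (simp only: scal_minus_left mult_minus_right minus_divide_left[symmetric] neg_equal_iff_equal)
  obtain m where m: "n = Suc m" using assms by (cases n) auto
  have qq: "(\<alpha> ^ n + \<beta> ^ n) * qint (int n) = (-1) ^ n * qint (2 * int n)"
  proof -
    have key: "(A + s * R) * (R - s * A) = s * (R\<^sup>2 - A\<^sup>2)" if "A * R = 1" "s * s = 1" for A R s :: ratfun
      using that by algebra
    have "qvar ^ n * inverse qvar ^ n = 1"
      by (simp flip: power_mult_distrib)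
    note key = key[OF this minus_one_mult_self]
    have "?c * ((\<alpha> ^ n + \<beta> ^ n) * qint (int n)) = (\<alpha> ^ n + \<beta> ^ n) * (?c * qint (int n))"
      by (rule mult.left_commute)
    also have "\<dots> = (-1) ^ n * (inverse qvar ^ (2 * n) - (-1) ^ (2 * n) * qvar ^ (2 * n))"
      unfolding qint_nat power_minus[of "inverse qvar"] key power_even_eq by (simp add: power2_eq_square)
    also have "\<dots> = ?c * ((-1) ^ n * qint (2 * int n))"
      using qint_nat[of "2 * n"] by simp
    finally show ?thesis using qvar_sum_nonzero by simp
  qed
  have om: "omega ^ n = ?c * (qvar powi (- 2 * int n) * ?c ^ (2 * n - 1))"
  proof -
    have "?c * ?c ^ (2 * n - 1) = ?c ^ (2 * n)"
      using assms by (simp flip: power_Suc)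
    moreover have "qvar powi (- 2 * int n) = (inverse qvar) ^ (2 * n)"
    proof -
      have "- 2 * int n = - int (2 * n)" by simp
      then show ?thesis by (simp only: power_int_minus power_int_of_nat power_inverse)
    qed
    ultimately show ?thesis
      by (simp add: omega_def power_mult_distrib mult_ac flip: power_mult)
  qed
  have "?c *\<^sub>s Phi (E_Beck n) = ?c *\<^sub>s (((-1) ^ n * (qint (2 * int n) / of_nat n)
      * qvar powi (- 2 * int n) * ?c ^ (2 * n - 1)) *\<^sub>s snoc (cons X (cat (n - 1))) Y)"
  proof -
    have "omega ^ n * ((\<alpha> ^ n + \<beta> ^ n) / of_nat n) * qint (int n)
      = omega ^ n * ((\<alpha> ^ n + \<beta> ^ n) * qint (int n)) / of_nat n"
      by simp
    also have "\<dots> = ?c * ((-1) ^ n * (qint (2 * int n) / of_nat n) * qvar powi (- 2 * int n) * ?c ^ (2 * n - 1))"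
      unfolding qq om by (simp only: times_divide_eq_right times_divide_eq_left mult_ac)
    finally show ?thesis
      unfolding 1 by (simp only: m L_nth K_nth scal_simps diff_Suc_1)
  qed
  then have "Phi (E_Beck n) = ((-1) ^ n * (qint (2 * int n) / of_nat n)
      * qvar powi (- 2 * int n) * ?c ^ (2 * n - 1)) *\<^sub>s snoc (cons X (cat (n - 1))) Y"
    by (rule qsum_cancel)
  then have "Rep_qshuf (Phi (E_Beck n)) = Rep_qshuf (((-1) ^ n * (qint (2 * int n) / of_nat n)
      * qvar powi (- 2 * int n) * ?c ^ (2 * n - 1)) *\<^sub>s snoc (cons X (cat (n - 1))) Y)"
    by simp
  then show ?thesis
    by (simp add: Rep_Phi scal.rep_eq snoc.rep_eq cons.rep_eq cat.rep_eq)
qed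

end
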